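(* For every $\varepsilon>0$, the number of monic cubic polynomials $f(X)=X^3+aX^2+bX+c$ with $a,b,c\in\mathbb Z\cap[-H,H]$ which are irreducible over $\mathbb Q$ and whose Galois group over $\mathbb Q$ is not isomorphic to $S_3$ is $O_\varepsilon(H^{1.5+\varepsilon})$ as $H\to\infty$. *)

theory Defs
  imports "HOL-Algebra.Sym_Groups" "HOL-Computational_Algebra.Computational_Algebra"
    "HOL-Library.Landau_Symbols"
begin

definition croots :: "rat poly \<Rightarrow> complex set" where
  "croots f = {z. poly (map_poly of_rat f) z = 0}"

definition is_subfield :: "complex set \<Rightarrow> bool" where
  "is_subfield K \<longleftrightarrow> 0 \<in> K \<and> 1 \<in> K \<and> (\<forall>x\<in>K. \<forall>y\<in>K. x + y \<in> K \<and> x * y \<in> K)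
     \<and> (\<forall>x\<in>K. - x \<in> K \<and> inverse x \<in> K)"

text \<open>The splitting field of f inside the complex numbers: the smallest subfield
  containing all complex roots of f (it automatically contains the rationals).\<close>
definition splitting_field :: "rat poly \<Rightarrow> complex set" where
  "splitting_field f = \<Inter> {K. is_subfield K \<and> croots f \<subseteq> K}"

text \<open>Field automorphisms of the splitting field over the rationals (every ring
  automorphism of a field of characteristic 0 fixes the rationals pointwise),
  as extensional maps.\<close>
definition gal_auts :: "rat poly \<Rightarrow> (complex \<Rightarrow> complex) set" where
  "gal_auts f = {\<sigma>. \<sigma> \<in> extensional (splitting_field f)
      \<and> bij_betw \<sigma> (splitting_field f) (splitting_field f)
      \<and> (\<forall>x\<in>splitting_field f. \<forall>y\<in>splitting_field f.
            \<sigma> (x + y) = \<sigma> x + \<sigma> y \<and> \<sigma> (x * y) = \<sigma> x * \<sigma> y)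
      \<and> (\<forall>q::rat. \<sigma> (of_rat q) = of_rat q)}"

definition galois_group :: "rat poly \<Rightarrow> (complex \<Rightarrow> complex) monoid" where
  "galois_group f = \<lparr>carrier = gal_auts f,
     mult = (\<lambda>\<sigma> \<tau>. compose (splitting_field f) \<sigma> \<tau>),
     one = restrict id (splitting_field f)\<rparr>"

definition count_non_S3 :: "real \<Rightarrow> nat" where
  "count_non_S3 H = card {(a::int, b::int, c::int).
      \<bar>real_of_int a\<bar> \<le> H \<and> \<bar>real_of_int b\<bar> \<le> H \<and> \<bar>real_of_int c\<bar> \<le> H \<and>
      irreducible [:of_int c, of_int b, of_int a, 1 :: rat:] \<and>
      \<not> (galois_group [:of_int c, of_int b, of_int a, 1 :: rat:] \<cong> sym_group 3)}"

end

theory Submission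
  imports Defs "HOL-Computational_Algebra.Field_as_Ring" "HOL-Real_Asymp.Real_Asymp"
begin

text \<open>An irreducible cubic whose Galois group is not \<open>S\<^sub>3\<close> has a square discriminant \<open>Y\<^sup>2\<close>. With
  \<open>I = a\<^sup>2 - 3b\<close> and \<open>J = 2a\<^sup>3 - 9ab + 27c\<close> this reads \<open>J\<^sup>2 + 27Y\<^sup>2 = 4I\<^sup>3\<close>, so the Eisenstein integer
  \<open>\<alpha> = (J + 3Y\<surd>-3)/2\<close> has norm \<open>I\<^sup>3\<close>, and unique factorization gives \<open>\<alpha> = N(\<xi>) \<xi> \<gamma>\<^sup>3\<close> with
  \<open>I = N(\<xi>) N(\<gamma>)\<close>. The triple \<open>(a, \<xi>, \<gamma>)\<close> determines \<open>(a, b, c)\<close>, and it is counted in the dyadic boxes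
  \<open>\<bar>\<xi>\<bar> \<sim> R\<close>, \<open>\<bar>\<gamma>\<bar> \<sim> S\<close>. If \<open>a\<^sup>2 < 6H\<close> then \<open>R\<^sup>2S\<^sup>2 \<lesssim> H\<close> and there are \<open>O(\<surd>H)\<close> choices of \<open>a\<close>. Otherwise
  \<open>a\<^sup>2 = I + O(H)\<close> leaves \<open>O(H/(RS))\<close> choices of \<open>a\<close>, while \<open>\<bar>Y\<bar> \<lesssim> \<bar>a\<bar>H\<close> forces \<open>\<xi>\<gamma>\<^sup>3\<close> close to the real axis:
  fixing the smaller of \<open>\<xi>\<close>, \<open>\<gamma>\<close> confines the larger one to at most three thin strips, which leaves
  \<open>O(H + RS min(R, S))\<close> pairs. Each of the \<open>O(log\<^sup>2 H)\<close> boxes thus contributes \<open>O(H\<^sup>3\<^sup>/\<^sup>2)\<close>.\<close>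

section \<open>Eisenstein integers\<close>

text \<open>\<open>Eis x y\<close> stands for \<open>x + y\<omega>\<close>, where \<open>\<omega>\<close> is a primitive cube root of unity.\<close>

datatype eis = Eis (cx: int) (cy: int)

lemma eis_eq_iff: "x = y \<longleftrightarrow> cx x = cx y \<and> cy x = cy y"
  by (auto intro: eis.expand)

instantiation eis :: comm_ring_1
begin

definition "0 = Eis 0 0"
definition "1 = Eis 1 0"
definition "x + y = Eis (cx x + cx y) (cy x + cy y)"
definition "x - y = Eis (cx x - cx y) (cy x - cy y)"
definition "- x = Eis (- cx x) (- cy x)"
definition "x * y = Eis (cx x * cx y - cy x * cy y) (cx x * cy y + cy x * cx y - cy x * cy y)"

instance
  by standard
    (simp_all add: eis_eq_iff zero_eis_def one_eis_def plus_eis_def minus_eis_def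
      uminus_eis_def times_eis_def algebra_simps)

end

lemma eis_sel [simp]:
  "cx 0 = 0" "cy 0 = 0" "cx 1 = 1" "cy 1 = 0"
  "cx (x + y) = cx x + cx y" "cy (x + y) = cy x + cy y"
  "cx (x - y) = cx x - cx y" "cy (x - y) = cy x - cy y"
  "cx (- x) = - cx x" "cy (- x) = - cy x"
  "cx (x * y) = cx x * cx y - cy x * cy y"
  "cy (x * y) = cx x * cy y + cy x * cx y - cy x * cy y"
  by (simp_all add: zero_eis_def one_eis_def plus_eis_def minus_eis_def
      uminus_eis_def times_eis_def)

lemma of_int_eis [simp]: "cx (of_int k) = k" "cy (of_int k) = 0"
proof -
  have "of_nat n = Eis (int n) 0" for n
    by (induction n) (simp_all add: eis_eq_iff)
  hence "of_int k = Eis k 0"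
    by (cases k rule: int_cases2) (simp_all add: eis_eq_iff)
  thus "cx (of_int k) = k" "cy (of_int k) = 0" by simp_all
qed

definition econj :: "eis \<Rightarrow> eis" where
  "econj z = Eis (cx z - cy z) (- cy z)"

definition enorm :: "eis \<Rightarrow> int" where
  "enorm z = (cx z)\<^sup>2 - cx z * cy z + (cy z)\<^sup>2"

lemma econj_sel [simp]: "cx (econj z) = cx z - cy z" "cy (econj z) = - cy z"
  by (simp_all add: econj_def)

lemma econj_mult: "econj (x * y) = econj x * econj y"
  by (simp add: eis_eq_iff algebra_simps)

lemma econj_power: "econj (x ^ n) = econj x ^ n"
  by (induction n) (simp_all add: econj_mult eis_eq_iff)

lemma econj_econj [simp]: "econj (econj x) = x"
  by (simp add: eis_eq_iff)

lemma mult_econj: "z * econj z = of_int (enorm z)"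
  by (simp add: eis_eq_iff enorm_def power2_eq_square algebra_simps)

lemma enorm_mult: "enorm (x * y) = enorm x * enorm y"
  by (simp add: enorm_def power2_eq_square algebra_simps)

lemma enorm_power: "enorm (x ^ n) = enorm x ^ n"
  by (induction n) (simp_all add: enorm_mult, simp add: enorm_def)

lemma enorm_econj [simp]: "enorm (econj z) = enorm z"
  by (simp add: enorm_def power2_eq_square algebra_simps)

lemma enorm_of_int [simp]: "enorm (of_int k) = k\<^sup>2"
  by (simp add: enorm_def)

lemma four_enorm: "4 * enorm z = (2 * cx z - cy z)\<^sup>2 + 3 * (cy z)\<^sup>2"
  by (simp add: enorm_def power2_eq_square algebra_simps)

lemma four_enorm': "4 * enorm z = (2 * cy z - cx z)\<^sup>2 + 3 * (cx z)\<^sup>2"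
  by (simp add: enorm_def power2_eq_square algebra_simps)

lemma enorm_0 [simp]: "enorm 0 = 0" and enorm_1 [simp]: "enorm 1 = 1"
  by (simp_all add: enorm_def)

lemma enorm_nonneg [simp]: "enorm z \<ge> 0"
  using four_enorm[of z] by (smt (verit) zero_le_power2)

lemma enorm_eq_0_iff [simp]: "enorm z = 0 \<longleftrightarrow> z = 0"
proof
  assume "enorm z = 0"
  then show "z = 0"
    using four_enorm[of z] four_enorm'[of z]
    by (smt (verit) zero_le_power2 power2_eq_iff_nonneg eis_eq_iff eis_sel zero_eq_power2)
qed (simp add: enorm_def)

lemma enorm_pos: "z \<noteq> 0 \<Longrightarrow> enorm z > 0"
  using enorm_nonneg[of z] enorm_eq_0_iff[of z] by linarith

instance eis :: idom
proof
  fix x y :: eis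
  assume "x \<noteq> 0" "y \<noteq> 0"
  then have "enorm (x * y) \<noteq> 0" by (simp add: enorm_mult)
  then show "x * y \<noteq> 0" by auto
qed

section \<open>Division with remainder for Eisenstein integers\<close>

instantiation eis :: idom_modulo
begin

text \<open>The exact quotient is \<open>x * econj y\<close> over the integer
  \<open>enorm y\<close>. Each coordinate is rounded to a nearest integer, since
  \<open>(2 * p + n) div (2 * n)\<close> is the floor of p/n + 1/2; so both coordinates of the error
  are at most 1/2 in size.\<close>

definition divide_eis :: "eis \<Rightarrow> eis \<Rightarrow> eis" where
  "divide_eis x y = Eis ((2 * cx (x * econj y) + enorm y) div (2 * enorm y))
     ((2 * cy (x * econj y) + enorm y) div (2 * enorm y))"

definition modulo_eis :: "eis \<Rightarrow> eis \<Rightarrow> eis" where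
  "modulo_eis x y = x - x div y * y"

instance
proof
  fix x y :: eis
  show "x div 0 = 0"
    by (simp add: divide_eis_def zero_eis_def enorm_def)
  show "x * y div y = x" if "y \<noteq> 0"
  proof -
    have N: "enorm y > 0" using that by (rule enorm_pos)
    have "x * y * econj y = x * of_int (enorm y)"
      by (simp add: mult.assoc mult_econj)
    moreover have "(2 * (k * enorm y) + enorm y) div (2 * enorm y) = k" for k
    proof -
      have "(2 * (k * enorm y) + enorm y) div (2 * enorm y)
          = (enorm y + k * (2 * enorm y)) div (2 * enorm y)"
        by (simp add: algebra_simps)
      also have "\<dots> = k + enorm y div (2 * enorm y)" using N by (intro div_mult_self1) auto
      also have "\<dots> = k" using N by simp
      finally show ?thesis .
    qed
    ultimately show ?thesis
      by (simp add: divide_eis_def eis_eq_iff)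
  qed
  show "x div y * y + x mod y = x" by (simp add: modulo_eis_def)
qed

end

lemma abs_round_remainder:
  fixes p n :: int
  assumes "n > 0"
  shows "2 * \<bar>p - n * ((2 * p + n) div (2 * n))\<bar> \<le> n"
proof -
  define q where "q = (2 * p + n) div (2 * n)"
  have "2 * p + n = 2 * n * q + (2 * p + n) mod (2 * n)"
    unfolding q_def by simp
  moreover have "0 \<le> (2 * p + n) mod (2 * n)" "(2 * p + n) mod (2 * n) < 2 * n"
    using assms by simp_all
  ultimately have "2 * (n * q) - n \<le> 2 * p" "2 * p \<le> 2 * (n * q) + n" by linarith+
  then show ?thesis unfolding q_def[symmetric] by (simp add: abs_if algebra_simps)
qed

text \<open>Multiplied by \<open>econj y\<close>, the remainder has coordinates of size at most n/2,
  hence norm at most 3n^2/4. Cancelling the norm n of \<open>econj y\<close> leaves at most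
  3n/4.\<close>

lemma enorm_mod_less:
  assumes "y \<noteq> 0"
  shows "enorm (x mod y) < enorm y"
proof -
  define n where "n = enorm y"
  have n: "n > 0" using assms enorm_pos n_def by blast
  define r where "r = (x mod y) * econj y"
  define p where "p = x * econj y"
  have "r = p - (x div y) * of_int n"
    by (simp add: r_def p_def modulo_eis_def n_def mult_econj[symmetric] algebra_simps)
  moreover have "x div y = Eis ((2 * cx p + n) div (2 * n)) ((2 * cy p + n) div (2 * n))"
    by (simp only: divide_eis_def p_def n_def)
  ultimately have "2 * \<bar>cx r\<bar> \<le> n" "2 * \<bar>cy r\<bar> \<le> n"
    using abs_round_remainder[OF n] by (simp_all add: mult.commute)
  then have "(2 * \<bar>cx r\<bar>)\<^sup>2 \<le> n\<^sup>2" "(2 * \<bar>cy r\<bar>)\<^sup>2 \<le> n\<^sup>2" "(2 * \<bar>cx r\<bar>) * (2 * \<bar>cy r\<bar>) \<le> n * n"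
    by (intro power_mono mult_mono; simp)+
  moreover have "- (cx r * cy r) \<le> \<bar>cx r\<bar> * \<bar>cy r\<bar>"
    using abs_ge_minus_self[of "cx r * cy r"] by (simp add: abs_mult)
  ultimately have "4 * enorm r \<le> 3 * n\<^sup>2"
    by (simp add: enorm_def power_mult_distrib power2_eq_square)
  moreover have "enorm r = enorm (x mod y) * n" by (simp add: r_def enorm_mult n_def)
  ultimately have "4 * enorm (x mod y) * n \<le> 3 * n * n" by (simp add: power2_eq_square)
  then have "4 * enorm (x mod y) \<le> 3 * n" using n by simp
  then show ?thesis using n unfolding n_def by linarith
qed

instantiation eis :: normalization_euclidean_semiring
begin

definition euclidean_size_eis :: "eis \<Rightarrow> nat" where
  "euclidean_size_eis z = nat (enorm z)"

text \<open>No canonical choice of associates is needed, so an arbitrary one is taken;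
  only the class of units is pinned down.\<close>

definition normalize_eis :: "eis \<Rightarrow> eis" where
  "normalize_eis z = (if z dvd 1 then 1 else SOME w. z dvd w \<and> w dvd z)"

definition unit_factor_eis :: "eis \<Rightarrow> eis" where
  "unit_factor_eis z = z div normalize z"

instance
proof
  have assoc: "z dvd normalize z \<and> normalize z dvd z" for z :: eis
  proof (cases "z dvd 1")
    case False
    have "z dvd (SOME w. z dvd w \<and> w dvd z) \<and> (SOME w. z dvd w \<and> w dvd z) dvd z"
      by (rule someI[of _ z]) simp
    then show ?thesis using False by (simp add: normalize_eis_def)
  qed (simp add: normalize_eis_def)
  have norm0: "normalize z = 0 \<longleftrightarrow> z = 0" for z :: eis
    using assoc[of z] by auto
  fix x y :: eis
  show "euclidean_size (0 :: eis) = 0" by (simp add: euclidean_size_eis_def)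
  show "euclidean_size (x mod y) < euclidean_size y" if "y \<noteq> 0"
    using enorm_mod_less[OF that, of x] enorm_pos[OF that] by (simp add: euclidean_size_eis_def)
  show "euclidean_size x \<le> euclidean_size (x * y)" if "y \<noteq> 0"
  proof -
    have "enorm x * 1 \<le> enorm x * enorm y"
      using enorm_pos[OF that] by (intro mult_left_mono) auto
    then show ?thesis by (simp add: euclidean_size_eis_def enorm_mult)
  qed
  show "unit_factor (0 :: eis) = 0"
    by (simp add: unit_factor_eis_def)
  show "normalize (0 :: eis) = 0" using norm0 by simp
  show "unit_factor x * normalize x = x"
    using assoc[of x] by (simp add: unit_factor_eis_def)
  show "unit_factor x = x" if "x dvd 1"
    using that by (simp add: unit_factor_eis_def normalize_eis_def)
  show "unit_factor x dvd 1" if "x \<noteq> 0"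
  proof -
    have "x dvd normalize x" "normalize x dvd x" using assoc by auto
    then obtain u v where u: "normalize x = x * u" and v: "x = normalize x * v"
      by (elim dvdE)
    then have "x * (u * v) = x * 1" by (metis mult.assoc mult_1_right)
    then have "u * v = 1" using that by simp
    moreover have "unit_factor x = v"
      using v that norm0[of x] unfolding unit_factor_eis_def
      by (metis nonzero_mult_div_cancel_left)
    ultimately show ?thesis by (metis dvd_triv_right)
  qed
  show "unit_factor (x * y) = x * unit_factor y" if unit: "x dvd 1"
  proof -
    obtain k where k: "1 = x * k" using unit by (elim dvdE)
    \<comment> \<open>Associated elements satisfy the same divisibility conditions, so the choice
      operator in \<open>normalize\<close> picks the same representative for \<open>x * y\<close>
      and \<open>y\<close>.\<close>
    have xy: "x * y dvd w \<longleftrightarrow> y dvd w" "w dvd x * y \<longleftrightarrow> w dvd y" for w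
    proof -
      have "y = x * y * k" using k by (metis mult.commute mult.left_commute mult_1)
      then have "x * y dvd y" by (metis dvd_triv_left)
      then show "x * y dvd w \<longleftrightarrow> y dvd w" "w dvd x * y \<longleftrightarrow> w dvd y"
        by (meson dvd_trans dvd_triv_right)+
    qed
    have "normalize (x * y) = normalize y"
      by (simp add: normalize_eis_def xy)
    then show ?thesis
      using assoc[of y] by (simp add: unit_factor_eis_def div_mult_swap)
  qed
qed

end

section \<open>Eisenstein integers whose norm is a cube\<close>

lemma eis_is_unit_iff: "is_unit z \<longleftrightarrow> enorm z = 1" for z :: eis
proof
  assume "is_unit z"
  then obtain w where "1 = z * w" by (elim dvdE)
  then have "enorm z * enorm w = 1" by (metis enorm_mult enorm_of_int of_int_1 one_power2)
  then show "enorm z = 1"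
    using enorm_nonneg[of z] by (metis abs_of_nonneg zmult_eq_1_iff abs_minus_cancel abs_1)
next
  assume "enorm z = 1"
  then have "z * econj z = 1" by (simp add: mult_econj)
  then show "is_unit z" by (metis dvd_triv_left)
qed

text \<open>Induction on m. If the cube of a nonunit \<delta> divides \<alpha>, it is split off and
  \<delta> is absorbed into \<gamma>. Otherwise \<alpha> and its conjugate are both free of cubes,
  and comparing multiplicities in \<alpha> * \<open>econj\<close> \<alpha> = m^3 shows that m
  divides \<alpha>; then \<xi> = \<alpha> / m has norm m, and \<gamma> = 1.\<close>

lemma norm_cube_decomposition:
  fixes \<alpha> :: eis
  assumes "m > 0" "enorm \<alpha> = m ^ 3"
  shows "\<exists>\<xi> \<gamma>. \<alpha> = of_int (enorm \<xi>) * \<xi> * \<gamma> ^ 3 \<and> enorm \<xi> * enorm \<gamma> = m"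
  using assms
proof (induction "nat m" arbitrary: m \<alpha> rule: less_induct)
  case less
  have "\<alpha> \<noteq> 0" using less.prems by (metis enorm_eq_0_iff less_irrefl power_eq_0_iff)
  show ?case
  proof (cases "\<exists>\<delta>. \<not> is_unit \<delta> \<and> \<delta> ^ 3 dvd \<alpha>")
    case True
    then obtain \<delta> \<beta> where \<delta>: "\<not> is_unit \<delta>" and \<beta>: "\<alpha> = \<delta> ^ 3 * \<beta>" by (elim exE conjE dvdE)
    have N: "m ^ 3 = enorm \<delta> ^ 3 * enorm \<beta>"
      using less.prems \<beta> by (simp add: enorm_mult enorm_power)
    then have "enorm \<delta> ^ 3 dvd m ^ 3" by simp
    then have "enorm \<delta> dvd m" by simp
    then obtain k where k: "m = enorm \<delta> * k" by (elim dvdE)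
    have "\<delta> \<noteq> 0" using \<open>\<alpha> \<noteq> 0\<close> \<beta> by auto
    then have d0: "enorm \<delta> > 0" by (rule enorm_pos)
    then have d2: "enorm \<delta> > 1" using \<delta> eis_is_unit_iff by (smt (verit))
    have "k > 0" using k d0 less.prems(1) by (simp add: zero_less_mult_iff)
    moreover have "enorm \<beta> = k ^ 3" using N k d0 by (auto simp: power_mult_distrib)
    moreover have "nat k < nat m" using k d2 \<open>k > 0\<close> by simp
    ultimately obtain \<xi> \<gamma> where "\<beta> = of_int (enorm \<xi>) * \<xi> * \<gamma> ^ 3" "enorm \<xi> * enorm \<gamma> = k"
      using less.hyps by blast
    then have "\<alpha> = of_int (enorm \<xi>) * \<xi> * (\<delta> * \<gamma>) ^ 3 \<and> enorm \<xi> * enorm (\<delta> * \<gamma>) = m"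
      using \<beta> k by (simp add: power_mult_distrib enorm_mult)
    then show ?thesis by blast
  next
    case False
    have "(of_int m :: eis) dvd \<alpha>"
    proof (rule multiplicity_le_imp_dvd)
      show "(of_int m :: eis) \<noteq> 0" using less.prems(1) by (simp add: eis_eq_iff)
      fix p :: eis
      assume p: "prime p"
      then have nu: "\<not> is_unit p" by auto
      then have nu': "\<not> is_unit (econj p)" by (simp add: eis_is_unit_iff)
      have "\<not> p ^ 3 dvd \<alpha>" using False nu by blast
      then have 1: "multiplicity p \<alpha> < 3"
        using multiplicity_dvd'[of 3 p \<alpha>] by linarith
      have "\<not> p ^ 3 dvd econj \<alpha>"
      proof
        assume "p ^ 3 dvd econj \<alpha>"
        then obtain t where "econj \<alpha> = p ^ 3 * t" by (elim dvdE)
        then have "\<alpha> = econj p ^ 3 * econj t" by (metis econj_econj econj_mult econj_power)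
        then show False using False nu' by auto
      qed
      then have 2: "multiplicity p (econj \<alpha>) < 3"
        using multiplicity_dvd'[of 3 p "econj \<alpha>"] by linarith
      have "multiplicity p (\<alpha> * econj \<alpha>) = multiplicity p \<alpha> + multiplicity p (econj \<alpha>)"
        using p \<open>\<alpha> \<noteq> 0\<close>
        by (intro prime_elem_multiplicity_mult_distrib) (auto simp: eis_eq_iff)
      moreover have "\<alpha> * econj \<alpha> = of_int m ^ 3"
        using less.prems(2) by (simp add: mult_econj)
      moreover have "multiplicity p ((of_int m :: eis) ^ 3) = 3 * multiplicity p (of_int m)"
        using p less.prems(1)
        by (intro prime_elem_multiplicity_power_distrib) (auto simp: eis_eq_iff)
      ultimately have "3 * multiplicity p (of_int m) = multiplicity p \<alpha> + multiplicity p (econj \<alpha>)"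
        by simp
      \<comment> \<open>Two multiplicities of at most 2 whose sum is divisible by 3 add up to 0 or
        3. In the second case m has multiplicity 1 and neither summand is 0.\<close>
      then show "multiplicity p (of_int m) \<le> multiplicity p \<alpha>"
        using 1 2 by linarith
    qed
    then obtain \<xi> where \<xi>: "\<alpha> = of_int m * \<xi>" by (elim dvdE)
    then have "m ^ 3 = m\<^sup>2 * enorm \<xi>" using less.prems by (simp add: enorm_mult)
    then have "enorm \<xi> = m" using less.prems(1) by (simp add: power2_eq_square power3_eq_cube)
    then have "\<alpha> = of_int (enorm \<xi>) * \<xi> * 1 ^ 3 \<and> enorm \<xi> * enorm 1 = m"
      using \<xi> by (simp add: enorm_def)
    then show ?thesis by blast
  qed
qed

section \<open>The Galois group of a cubic with nonsquare discriminant\<close>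

text \<open>The discriminant of X^3 + aX^2 + bX + c. It is polymorphic because it is used over the
  integers, rationals, reals and complex numbers.\<close>

definition cubic_disc :: "'a::comm_ring_1 \<Rightarrow> 'a \<Rightarrow> 'a \<Rightarrow> 'a" where
  "cubic_disc a b c = a\<^sup>2 * b\<^sup>2 - 4 * b ^ 3 - 4 * a ^ 3 * c + 18 * a * b * c - 27 * c\<^sup>2"

section \<open>Evaluation of rational polynomials at complex numbers\<close>

definition qeval :: "rat poly \<Rightarrow> complex \<Rightarrow> complex" where
  "qeval u z = poly (map_poly of_rat u) z"

lemma qeval_0 [simp]: "qeval 0 z = 0"
  by (simp add: qeval_def)

lemma qeval_pCons [simp]: "qeval (pCons q u) z = of_rat q + z * qeval u z"
  by (simp add: qeval_def map_poly_pCons)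

lemma qeval_1 [simp]: "qeval 1 z = 1"
  by (simp add: one_pCons)

lemma qeval_add [simp]: "qeval (u + v) z = qeval u z + qeval v z"
proof (induction u arbitrary: v)
  case (pCons q u)
  then show ?case by (cases v) (simp add: of_rat_add algebra_simps)
qed simp

lemma qeval_smult [simp]: "qeval (smult q v) z = of_rat q * qeval v z"
  by (induction v) (simp_all add: of_rat_mult algebra_simps)

lemma qeval_minus [simp]: "qeval (- u) z = - qeval u z"
  by (induction u) (simp_all add: of_rat_minus algebra_simps)

lemma qeval_diff [simp]: "qeval (u - v) z = qeval u z - qeval v z"
  using qeval_add[of u "- v" z] by simp

lemma qeval_mult [simp]: "qeval (u * v) z = qeval u z * qeval v z"
  by (induction u) (simp_all add: algebra_simps)

lemma qeval_power [simp]: "qeval (u ^ n) z = qeval u z ^ n"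
  by (induction n) simp_all

lemma subfield_of_rat: "is_subfield K \<Longrightarrow> of_rat q \<in> K"
proof -
  assume K: "is_subfield K"
  have nat: "of_nat n \<in> K" for n
    using K by (induction n) (auto simp: is_subfield_def)
  have int: "of_int k \<in> K" for k
    using nat K by (cases k rule: int_cases2) (auto simp: is_subfield_def)
  obtain m n where q: "q = of_int m / of_int n"
    using quotient_of_div[of q] by (metis surj_pair)
  have "of_int m * inverse (of_int n) \<in> K"
    using int K by (simp add: is_subfield_def)
  moreover have "(of_rat q :: complex) = of_int m * inverse (of_int n)"
    by (simp add: q of_rat_divide divide_inverse of_rat_mult of_rat_inverse)
  ultimately show ?thesis by simp
qed

lemma subfield_qeval: "is_subfield K \<Longrightarrow> z \<in> K \<Longrightarrow> qeval u z \<in> K"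
  by (induction u) (auto simp: is_subfield_def subfield_of_rat)

lemma splitting_field_subfield: "is_subfield (splitting_field f)"
  by (auto simp: splitting_field_def is_subfield_def)

lemma croots_subset_splitting_field: "croots f \<subseteq> splitting_field f"
  by (auto simp: splitting_field_def)

text \<open>The first hypothesis says that t is a root of the cubic divided by X - s. With the third
  root u = -a - s - t the three factors are s - t, s - u and t - u, so this is the discriminant as
  the squared product of root differences; coinciding roots are allowed.\<close>

lemma cubic_disc_roots:
  fixes s t a b c :: complex
  assumes "t\<^sup>2 + (a + s) * t + (s\<^sup>2 + a * s + b) = 0" "s ^ 3 + a * s\<^sup>2 + b * s + c = 0"
  shows "cubic_disc a b c = ((s - t) * (2 * s + t + a) * (2 * t + s + a))\<^sup>2"
proof -
  have b: "b = - (t\<^sup>2 + (a + s) * t + s\<^sup>2 + a * s)"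
    using assms(1) by (simp add: eq_neg_iff_add_eq_0 algebra_simps)
  have c: "c = - (s ^ 3 + a * s\<^sup>2 + b * s)"
    using assms(2) by (simp add: eq_neg_iff_add_eq_0 algebra_simps)
  show ?thesis unfolding cubic_disc_def c unfolding b by algebra
qed

section \<open>Roots of an irreducible cubic with nonsquare discriminant\<close>

locale nonsquare_cubic =
  fixes a b c :: rat and f :: "rat poly"
  defines "f \<equiv> [:c, b, a, 1:]"
  assumes irred: "irreducible f"
    and nonsquare: "\<And>q. q\<^sup>2 \<noteq> cubic_disc a b c"
begin

lemma qeval_f: "qeval f z = z ^ 3 + of_rat a * z\<^sup>2 + of_rat b * z + of_rat c"
  by (simp add: f_def power2_eq_square power3_eq_cube algebra_simps)

lemma croots_f: "croots f = {z. qeval f z = 0}"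
  by (simp add: croots_def qeval_def)

lemma degree_f: "degree f = 3"
  by (simp add: f_def)

definition root_pair :: "complex \<Rightarrow> complex \<Rightarrow> bool" where
  "root_pair s t \<longleftrightarrow> s \<noteq> t \<and> qeval f s = 0 \<and> qeval f t = 0"

lemma root_pair_quadratic:
  assumes "root_pair s t"
  shows "t\<^sup>2 + (of_rat a + s) * t + (s\<^sup>2 + of_rat a * s + of_rat b) = 0"
proof -
  have "(s - t) * (t\<^sup>2 + (of_rat a + s) * t + (s\<^sup>2 + of_rat a * s + of_rat b))
      = qeval f s - qeval f t"
    unfolding qeval_f by (simp add: power2_eq_square power3_eq_cube algebra_simps)
  then show ?thesis using assms by (simp add: root_pair_def)
qed

text \<open>The quadratic relation replaces \<open>root_pair s t\<close>, so that the factorization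
  is available in \<open>obtain_roots\<close> before the roots are known to be distinct.\<close>

lemma factorization_at_roots:
  assumes "qeval f s = 0"
    and "t\<^sup>2 + (of_rat a + s) * t + (s\<^sup>2 + of_rat a * s + of_rat b) = 0"
  shows "qeval f z = (z - s) * (z - t) * (z - (- of_rat a - s - t))"
proof -
  have "(z - s) * (z - t) * (z - (- of_rat a - s - t))
      = qeval f z - qeval f s
        - (z - s) * (t\<^sup>2 + (of_rat a + s) * t + (s\<^sup>2 + of_rat a * s + of_rat b))"
    unfolding qeval_f by (simp add: power2_eq_square power3_eq_cube algebra_simps)
  then show ?thesis using assms by simp
qed

lemma third_root:
  assumes "root_pair s t" "qeval f z = 0"
  shows "z = s \<or> z = t \<or> z = - of_rat a - s - t"
proof -
  have "qeval f s = 0" using assms(1) by (simp add: root_pair_def)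
  then have "(z - s) * (z - t) * (z - (- of_rat a - s - t)) = 0"
    using factorization_at_roots[OF _ root_pair_quadratic[OF assms(1)]] assms(2) by metis
  then show ?thesis by (simp only: mult_eq_0_iff right_minus_eq disj_assoc)
qed

text \<open>Irreducibility makes \<open>f\<close> and \<open>u\<close> coprime, and a Bezout
  identity evaluated at \<open>s\<close> inverts \<open>qeval u s\<close> inside the polynomials in
  \<open>s\<close>.\<close>

lemma bezout_at_root:
  assumes "\<not> f dvd u" "qeval f s = 0"
  obtains y where "qeval y s * qeval u s = 1"
proof -
  have "prime_elem f" using irred by (rule irreducible_imp_prime_elem)
  then have "coprime f u" using assms(1) by (rule prime_elem_imp_coprime)
  then have "gcd f u = 1" by (rule coprime_imp_gcd_eq_1)
  moreover obtain x y where "x * f + y * u = gcd f u"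
    using bezout_coefficients_fst_snd[of f u] by (rule that)
  ultimately have "qeval (x * f + y * u) s = qeval 1 s" by (simp only:)
  then have "qeval y s * qeval u s = 1" using assms(2) by (simp only: qeval_add qeval_mult qeval_1) simp
  then show ?thesis by (rule that)
qed

lemma dvd_if_root:
  assumes "qeval f s = 0" "qeval u s = 0"
  shows "f dvd u"
proof (rule ccontr)
  assume "\<not> f dvd u"
  then obtain y where "qeval y s * qeval u s = 1" using assms(1) by (rule bezout_at_root)
  then show False using assms(2) by simp
qed

lemma qeval_eq_0_if_dvd: "f dvd u \<Longrightarrow> qeval f s = 0 \<Longrightarrow> qeval u s = 0"
  by (auto elim!: dvdE)

text \<open>Reduce U modulo the cubic to degree at most two. If U squared is the constant D at a root,
  then the cubic divides its square minus D, a polynomial of degree at most four,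
  so the cofactor has a rational root unless U is constant.\<close>

lemma square_at_root_imp_rational_square:
  assumes "qeval f s = 0" "(qeval U s)\<^sup>2 = of_rat D"
  shows "\<exists>q. q\<^sup>2 = D"
proof (rule ccontr)
  assume D: "\<not> (\<exists>q. q\<^sup>2 = D)"
  define V where "V = U mod f"
  have "f \<noteq> 0" using degree_f by auto
  have "qeval U s = qeval (U div f * f + U mod f) s" by simp
  also have "\<dots> = qeval V s" unfolding qeval_add qeval_mult assms(1) V_def by simp
  finally have "qeval (V\<^sup>2 - [:D:]) s = 0" using assms(2) by simp
  then have dvd: "f dvd V\<^sup>2 - [:D:]" by (rule dvd_if_root[OF assms(1)])
  have ne: "V\<^sup>2 - [:D:] \<noteq> 0"
  proof
    assume "V\<^sup>2 - [:D:] = 0"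
    then have "poly (V\<^sup>2 - [:D:]) 0 = 0" by simp
    then have "(poly V 0)\<^sup>2 = D" by simp
    then show False using D by blast
  qed
  have "degree V < 3"
    using degree_mod_less[OF \<open>f \<noteq> 0\<close>, of U] degree_f unfolding V_def by auto
  moreover have "degree (V\<^sup>2 - [:D:]) \<le> 2 * degree V"
    using degree_power_le[of V 2] by (intro degree_diff_le) (auto simp: mult.commute)
  moreover obtain l where l: "V\<^sup>2 - [:D:] = f * l" using dvd by (elim dvdE)
  moreover have "l \<noteq> 0" using l ne by auto
  then have "degree (f * l) = 3 + degree l"
    using \<open>f \<noteq> 0\<close> degree_f by (simp add: degree_mult_eq)
  ultimately have deg: "degree V = 2" "degree l \<le> 1" by auto
  have "degree (V\<^sup>2 - [:D:]) = 4"
  proof -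
    have "degree (V\<^sup>2) = 4" using deg(1) by (subst degree_power_eq) auto
    moreover have "V\<^sup>2 - [:D:] = V\<^sup>2 + [:- D:]" by simp
    ultimately show ?thesis using degree_add_eq_left[of "[:- D:]" "V\<^sup>2"] by (simp only: degree_pCons_0)
  qed
  then have "degree l = 1" using l \<open>degree (f * l) = 3 + degree l\<close> by simp
  obtain l0 m where m: "l = pCons l0 m" by (cases l)
  then have "degree m = 0" "m \<noteq> 0"
    using \<open>degree l = 1\<close> by (auto split: if_splits)
  then obtain l1 where "m = [:l1:]" "l1 \<noteq> 0" by (metis degree_eq_zeroE pCons_0_0)
  then have l01: "l = [:l0, l1:]" "l1 \<noteq> 0" using m by auto
  have "poly (V\<^sup>2 - [:D:]) (- l0 / l1) = 0"
    using l01 unfolding l by simp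
  then have "(poly V (- l0 / l1))\<^sup>2 = D" by simp
  then show False using D by blast
qed

lemma cubic_disc_of_rat:
  "(of_rat (cubic_disc a b c) :: complex) = cubic_disc (of_rat a) (of_rat b) (of_rat c)"
  by (simp add: cubic_disc_def of_rat_add of_rat_diff of_rat_mult of_rat_power)

text \<open>If t were w(s), the product of the root differences would be a rational polynomial in s.
  Its square is the rational discriminant, which would then be a rational square by the preceding
  descent.\<close>

lemma root_not_rational_in_root:
  assumes st: "root_pair s t"
  shows "qeval w s \<noteq> t"
proof
  assume w: "qeval w s = t"
  define U where "U = ([:0, 1:] - w) * ([:a, 2:] + w) * ([:a, 1:] + smult 2 w)"
  have "qeval U s = (s - t) * (2 * s + t + of_rat a) * (2 * t + s + of_rat a)"
    unfolding U_def by (simp only: qeval_mult qeval_add qeval_diff qeval_smult qeval_pCons qeval_0 w)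
      (simp add: add_ac)
  moreover have "s ^ 3 + of_rat a * s\<^sup>2 + of_rat b * s + of_rat c = 0"
    using st unfolding root_pair_def qeval_f by blast
  ultimately have "(qeval U s)\<^sup>2 = of_rat (cubic_disc a b c)"
    using cubic_disc_roots[OF root_pair_quadratic[OF st]] by (simp only: cubic_disc_of_rat)
  moreover have "qeval f s = 0" using st by (simp only: root_pair_def)
  ultimately obtain q where "q\<^sup>2 = cubic_disc a b c"
    using square_at_root_imp_rational_square by blast
  then show False using nonsquare by blast
qed

text \<open>Every element of \<open>\<rat>[s, t]\<close> has this form with u and v polynomials in s.\<close>

definition lin :: "rat poly \<times> rat poly \<Rightarrow> complex \<Rightarrow> complex \<Rightarrow> complex" where
  "lin p s t = qeval (fst p) s + qeval (snd p) s * t"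

text \<open>This makes substitution of root pairs well defined. A nonzero coefficient of t could be
  inverted at s, which would express t as a polynomial in s. So both coefficient polynomials vanish
  at s, hence are multiples of \<open>f\<close> and vanish at every root.\<close>

lemma lin_transfer:
  assumes st: "root_pair s t" and "root_pair s' t'" and z: "lin p s t = 0"
  shows "lin p s' t' = 0"
proof -
  have fs: "qeval f s = 0" "qeval f s' = 0" using assms by (auto simp: root_pair_def)
  have "f dvd snd p"
  proof (rule ccontr)
    assume "\<not> f dvd snd p"
    then obtain y where y: "qeval y s * qeval (snd p) s = 1"
      using bezout_at_root fs by blast
    have "qeval (- fst p * y) s = - qeval (fst p) s * qeval y s" by simp
    also have "- qeval (fst p) s = qeval (snd p) s * t"
      using z by (simp add: lin_def neg_eq_iff_add_eq_0)
    also have "\<dots> * qeval y s = t"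
      using y by (simp add: mult_ac)
    finally show False using root_not_rational_in_root[OF st] by blast
  qed
  moreover from this have "qeval (snd p) s = 0" using qeval_eq_0_if_dvd fs by blast
  then have "f dvd fst p" using z fs by (intro dvd_if_root) (auto simp: lin_def)
  ultimately show ?thesis
    using fs by (simp add: lin_def qeval_eq_0_if_dvd)
qed

section \<open>Arithmetic in the field generated by two roots\<close>

lemma lin_diff: "lin (fst p - fst q, snd p - snd q) s t = lin p s t - lin q s t"
  by (simp add: lin_def algebra_simps)

lemma lin_add: "lin (fst p + fst q, snd p + snd q) s t = lin p s t + lin q s t"
  by (simp add: lin_def algebra_simps)

lemma lin_minus: "lin (- fst p, - snd p) s t = - lin p s t"
  by (simp add: lin_def)

text \<open>The coordinates of the product after t^2 is replaced by -(a + s)t - (s^2 + as +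
  b).\<close>

definition lin_times :: "rat poly \<times> rat poly \<Rightarrow> rat poly \<times> rat poly \<Rightarrow> rat poly \<times> rat poly" where
  "lin_times p q = (fst p * fst q - snd p * snd q * [:b, a, 1:],
     fst p * snd q + snd p * fst q - snd p * snd q * [:a, 1:])"

lemma lin_times:
  assumes "root_pair s t"
  shows "lin (lin_times p q) s t = lin p s t * lin q s t"
proof -
  have "qeval [:b, a, 1:] s = s\<^sup>2 + of_rat a * s + of_rat b"
    "qeval [:a, 1:] s = of_rat a + s"
    by (simp_all add: power2_eq_square algebra_simps)
  then have "lin p s t * lin q s t - lin (lin_times p q) s t = qeval (snd p) s * qeval (snd q) s
      * (t\<^sup>2 + (of_rat a + s) * t + (s\<^sup>2 + of_rat a * s + of_rat b))"
    unfolding lin_def lin_times_def fst_conv snd_conv qeval_mult qeval_add qeval_diff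
    by (simp add: power2_eq_square algebra_simps del: qeval_pCons)
  then show ?thesis using root_pair_quadratic[OF assms] by simp
qed

text \<open>Taking fractions gives closure under inverses at once, without a separate proof that the
  numbers \<open>lin p s t\<close> already form a field.\<close>

definition lin_field :: "complex \<Rightarrow> complex \<Rightarrow> complex set" where
  "lin_field s t = {lin p s t / lin q s t | p q. lin q s t \<noteq> 0}"

lemma lin_fieldI: "lin q s t \<noteq> 0 \<Longrightarrow> lin p s t / lin q s t \<in> lin_field s t"
  unfolding lin_field_def by blast

lemma lin_fieldI': "lin p s t \<in> lin_field s t"
  using lin_fieldI[of "(1, 0)" s t p] by (simp add: lin_def)

lemma subfield_lin_field:
  assumes st: "root_pair s t"
  shows "is_subfield (lin_field s t)"
  unfolding is_subfield_def
proof (intro conjI ballI)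
  show "0 \<in> lin_field s t" "1 \<in> lin_field s t"
    using lin_fieldI'[of "(0, 0)" s t] lin_fieldI'[of "(1, 0)" s t] by (simp_all add: lin_def)
  fix x assume "x \<in> lin_field s t"
  then obtain p q where x: "x = lin p s t / lin q s t" "lin q s t \<noteq> 0"
    by (auto simp: lin_field_def)
  have "- x = lin (- fst p, - snd p) s t / lin q s t" using x by (simp add: lin_minus)
  then show "- x \<in> lin_field s t" using x lin_fieldI by metis
  show "inverse x \<in> lin_field s t"
  proof (cases "x = 0")
    case True
    then show ?thesis using \<open>0 \<in> lin_field s t\<close> by simp
  next
    case False
    then show ?thesis using x lin_fieldI[of p s t q] by simp
  qed
  fix y assume "y \<in> lin_field s t"
  then obtain p' q' where y: "y = lin p' s t / lin q' s t" "lin q' s t \<noteq> 0"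
    by (auto simp: lin_field_def)
  have qq: "lin (lin_times q q') s t \<noteq> 0" using x y by (simp add: lin_times[OF st])
  have "x * y = lin (lin_times p p') s t / lin (lin_times q q') s t"
    using x y by (simp add: lin_times[OF st])
  then show "x * y \<in> lin_field s t" using lin_fieldI[OF qq] by metis
  define r where "r = (fst (lin_times p q') + fst (lin_times p' q),
    snd (lin_times p q') + snd (lin_times p' q))"
  have "x + y = lin r s t / lin (lin_times q q') s t"
    unfolding r_def lin_add lin_times[OF st] by (simp only: x(1) y(1) add_frac_eq[OF x(2) y(2)])
  then show "x + y \<in> lin_field s t" using lin_fieldI[OF qq] by metis
qed

lemma lin_field_eq:
  assumes st: "root_pair s t"
  shows "lin_field s t = splitting_field f"
proof
  let ?K = "splitting_field f"
  have K: "is_subfield ?K" by (rule splitting_field_subfield)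
  have "s \<in> ?K" "t \<in> ?K"
    using st croots_subset_splitting_field[of f] by (auto simp: croots_f root_pair_def)
  then have "lin p s t \<in> ?K" for p
    using K subfield_qeval[OF K] by (auto simp: lin_def is_subfield_def)
  then show "lin_field s t \<subseteq> ?K"
    using K by (auto simp: lin_field_def is_subfield_def divide_inverse)
  \<comment> \<open>The pairs are coordinates of the three roots; the third root is -a - s - t
    because the roots add up to -a.\<close>
  have "s \<in> lin_field s t" "t \<in> lin_field s t" "- of_rat a - s - t \<in> lin_field s t"
    using lin_fieldI'[of "([:0, 1:], 0)" s t] lin_fieldI'[of "(0, 1)" s t]
      lin_fieldI'[of "([:- a, -1:], -1)" s t]
    by (simp_all add: lin_def of_rat_minus)
  then have "croots f \<subseteq> lin_field s t"
    using third_root[OF st] by (auto simp: croots_f)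
  then show "?K \<subseteq> lin_field s t"
    using subfield_lin_field[OF st] by (auto simp: splitting_field_def)
qed

section \<open>Automorphisms from substitution of root pairs\<close>

definition root_map :: "complex \<Rightarrow> complex \<Rightarrow> complex \<Rightarrow> complex \<Rightarrow> complex \<Rightarrow> complex" where
  "root_map s t s' t' = restrict
     (\<lambda>x. let pq = SOME pq. lin (snd pq) s t \<noteq> 0 \<and> x = lin (fst pq) s t / lin (snd pq) s t
       in lin (fst pq) s' t' / lin (snd pq) s' t') (splitting_field f)"

text \<open>The fraction chosen in \<open>root_map\<close> may differ from the given one. Equality
  of the two at (s, t) is, after cross multiplication, the vanishing of a single
  \<open>lin d s t\<close>, which \<open>lin_transfer\<close> carries over to (s', t').\<close>

lemma root_map_lin:
  assumes st: "root_pair s t" and st': "root_pair s' t'" and q: "lin q s t \<noteq> 0"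
  shows "root_map s t s' t' (lin p s t / lin q s t) = lin p s' t' / lin q s' t'"
proof -
  define x where "x = lin p s t / lin q s t"
  define pq where "pq = (SOME pq. lin (snd pq) s t \<noteq> 0 \<and> x = lin (fst pq) s t / lin (snd pq) s t)"
  define p1 q1 where "p1 = fst pq" and "q1 = snd pq"
  have 1: "lin q1 s t \<noteq> 0" "x = lin p1 s t / lin q1 s t"
    using someI[of "\<lambda>pq. lin (snd pq) s t \<noteq> 0 \<and> x = lin (fst pq) s t / lin (snd pq) s t" "(p, q)"]
    unfolding pq_def[symmetric] p1_def q1_def by (simp_all add: x_def q)
  have ne: "lin q1 s' t' \<noteq> 0" "lin q s' t' \<noteq> 0"
    using lin_transfer[OF st' st] 1 q by blast+
  define d where "d = (fst (lin_times p q1) - fst (lin_times p1 q),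
    snd (lin_times p q1) - snd (lin_times p1 q))"
  have "lin p s t / lin q s t = lin p1 s t / lin q1 s t" using 1(2) by (simp only: x_def)
  then have "lin d s t = 0"
    unfolding d_def lin_diff lin_times[OF st] by (simp only: frac_eq_eq[OF q 1(1)] right_minus_eq)
  then have "lin d s' t' = 0" by (rule lin_transfer[OF st st'])
  then have "lin p1 s' t' / lin q1 s' t' = lin p s' t' / lin q s' t'"
    unfolding d_def lin_diff lin_times[OF st'] by (simp only: frac_eq_eq[OF ne] right_minus_eq)
  moreover have "x \<in> splitting_field f"
    using lin_fieldI[OF q] lin_field_eq[OF st] unfolding x_def by blast
  ultimately show ?thesis
    unfolding x_def[symmetric] root_map_def by (simp add: pq_def[symmetric] p1_def q1_def)
qed

lemma root_map_lin':
  assumes "root_pair s t" "root_pair s' t'"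
  shows "root_map s t s' t' (lin p s t) = lin p s' t'"
  using root_map_lin[OF assms, of "(1, 0)" p] by (simp add: lin_def)

lemma root_map_gal:
  assumes st: "root_pair s t" and st': "root_pair s' t'"
  shows "root_map s t s' t' \<in> gal_auts f"
proof -
  let ?K = "splitting_field f"
  have ex: "\<exists>p q. lin q s t \<noteq> 0 \<and> x = lin p s t / lin q s t" if "root_pair s t" "x \<in> ?K" for x s t
    using that(2) unfolding lin_field_eq[OF that(1), symmetric] lin_field_def by blast
  have tr: "lin q s' t' \<noteq> 0" if "root_pair s t" "root_pair s' t'" "lin q s t \<noteq> 0" for q s t s' t'
    using lin_transfer that by blast
  have inv: "root_map s t s' t' x \<in> ?K \<and> root_map s' t' s t (root_map s t s' t' x) = x"
    if st: "root_pair s t" and st': "root_pair s' t'" and x: "x \<in> ?K" for x s t s' t'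
  proof -
    obtain p q where pq: "lin q s t \<noteq> 0" "x = lin p s t / lin q s t" using ex[OF st x] by blast
    then show ?thesis
      using root_map_lin[OF st st' pq(1)] root_map_lin[OF st' st tr[OF st st' pq(1)]]
        lin_fieldI[OF tr[OF st st' pq(1)]] lin_field_eq[OF st'] by auto
  qed
  \<comment> \<open>Exchanging the two root pairs gives the inverse map.\<close>
  have "bij_betw (root_map s t s' t') ?K ?K"
    by (rule bij_betwI[where g = "root_map s' t' s t"]) (use inv st st' in auto)
  moreover have "root_map s t s' t' (x + y) = root_map s t s' t' x + root_map s t s' t' y
      \<and> root_map s t s' t' (x * y) = root_map s t s' t' x * root_map s t s' t' y"
    if "x \<in> ?K" "y \<in> ?K" for x y
  proof -
    obtain p q where x: "lin q s t \<noteq> 0" "x = lin p s t / lin q s t" using ex[OF st] \<open>x \<in> ?K\<close> by blast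
    obtain p' q' where y: "lin q' s t \<noteq> 0" "y = lin p' s t / lin q' s t"
      using ex[OF st] \<open>y \<in> ?K\<close> by blast
    have ne: "lin q s' t' \<noteq> 0" "lin q' s' t' \<noteq> 0" using tr[OF st st'] x y by auto
    have qq: "lin (lin_times q q') s t \<noteq> 0" using x y by (simp add: lin_times[OF st])
    define r where "r = (fst (lin_times p q') + fst (lin_times p' q),
      snd (lin_times p q') + snd (lin_times p' q))"
    have sum: "x + y = lin r s t / lin (lin_times q q') s t"
      unfolding r_def lin_add lin_times[OF st] by (simp only: x(2) y(2) add_frac_eq[OF x(1) y(1)])
    have prod: "x * y = lin (lin_times p p') s t / lin (lin_times q q') s t"
      unfolding lin_times[OF st] by (simp only: x(2) y(2) times_divide_times_eq)
    have \<sigma>x: "root_map s t s' t' x = lin p s' t' / lin q s' t'"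
      unfolding x(2) by (rule root_map_lin[OF st st' x(1)])
    have \<sigma>y: "root_map s t s' t' y = lin p' s' t' / lin q' s' t'"
      unfolding y(2) by (rule root_map_lin[OF st st' y(1)])
    show ?thesis
      unfolding \<sigma>x \<sigma>y unfolding sum prod root_map_lin[OF st st' qq]
      unfolding r_def lin_add lin_times[OF st']
      by (simp add: add_frac_eq[OF ne])
  qed
  moreover have "root_map s t s' t' (of_rat q) = of_rat q" for q
    using root_map_lin'[OF st st', of "([:q:], 0)"] by (simp add: lin_def)
  ultimately show ?thesis
    by (auto simp: gal_auts_def root_map_def)
qed

section \<open>Automorphisms as permutations of the roots\<close>

lemma gal_qeval:
  assumes "\<sigma> \<in> gal_auts f" "x \<in> splitting_field f"
  shows "\<sigma> (qeval u x) = qeval u (\<sigma> x)"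
proof (induction u)
  case 0
  show ?case using assms by (auto simp: gal_auts_def dest: spec[of _ 0])
next
  case (pCons q u)
  have "of_rat q \<in> splitting_field f" "x * qeval u x \<in> splitting_field f" "qeval u x \<in> splitting_field f"
    using assms(2) splitting_field_subfield[of f] subfield_of_rat subfield_qeval
    by (auto simp: is_subfield_def)
  then show ?case using assms pCons by (simp add: gal_auts_def)
qed

lemma gal_lin:
  assumes \<sigma>: "\<sigma> \<in> gal_auts f" and st: "root_pair s t"
  shows "\<sigma> (lin p s t) = lin p (\<sigma> s) (\<sigma> t)"
proof -
  let ?K = "splitting_field f"
  have K: "is_subfield ?K" by (rule splitting_field_subfield)
  have in_K: "s \<in> ?K" "t \<in> ?K"
    using st croots_subset_splitting_field[of f] by (auto simp: croots_f root_pair_def)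
  then have "qeval (fst p) s \<in> ?K" "qeval (snd p) s \<in> ?K" "qeval (snd p) s * t \<in> ?K"
    using subfield_qeval[OF K] K by (auto simp: is_subfield_def)
  then show ?thesis
    using \<sigma> in_K gal_qeval[OF \<sigma>, of s] unfolding lin_def by (simp add: gal_auts_def)
qed

text \<open>Two roots generate the splitting field: every element times some nonzero
  \<open>lin q s t\<close> is another \<open>lin p s t\<close>, and the images of both are fixed by
  those of s and t. Injectivity keeps the image of the denominator nonzero, so it can be
  cancelled.\<close>

lemma gal_eqI:
  assumes \<sigma>: "\<sigma> \<in> gal_auts f" and \<tau>: "\<tau> \<in> gal_auts f" and st: "root_pair s t"
    and eq: "\<sigma> s = \<tau> s" "\<sigma> t = \<tau> t"
  shows "\<sigma> = \<tau>"
proof (rule extensionalityI)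
  let ?K = "splitting_field f"
  show "\<sigma> \<in> extensional ?K" "\<tau> \<in> extensional ?K" using \<sigma> \<tau> by (auto simp: gal_auts_def)
  fix x assume x: "x \<in> ?K"
  then obtain p q where pq: "lin q s t \<noteq> 0" "x = lin p s t / lin q s t"
    unfolding lin_field_eq[OF st, symmetric] lin_field_def by blast
  have K: "lin q s t \<in> ?K" "lin p s t \<in> ?K" using lin_fieldI' lin_field_eq[OF st] by blast+
  have "x * lin q s t = lin p s t" using pq by simp
  then have "\<sigma> x * \<sigma> (lin q s t) = \<sigma> (lin p s t)" "\<tau> x * \<tau> (lin q s t) = \<tau> (lin p s t)"
    using \<sigma> \<tau> x K by (auto simp: gal_auts_def) metis+
  then have "\<sigma> x * \<sigma> (lin q s t) = \<tau> x * \<sigma> (lin q s t)"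
    using gal_lin[OF \<sigma> st] gal_lin[OF \<tau> st] eq by simp
  moreover have "\<sigma> (lin q s t) \<noteq> 0"
  proof -
    have "\<sigma> 0 = 0" using \<sigma> gal_qeval[OF \<sigma> x, of 0] by simp
    moreover have "inj_on \<sigma> ?K" using \<sigma> by (auto simp: gal_auts_def bij_betw_def)
    moreover have "0 \<in> ?K" using splitting_field_subfield by (auto simp: is_subfield_def)
    ultimately show ?thesis using pq(1) K(1) by (metis inj_onD)
  qed
  ultimately show "\<sigma> x = \<tau> x" by simp
qed

text \<open>The fundamental theorem of algebra gives a root s of the cubic and a root t of its
  quadratic cofactor. The three roots are distinct because the discriminant, not being a square,
  differs from 0 = 0^2.\<close>

lemma obtain_roots:
  obtains r :: "nat \<Rightarrow> complex" where "inj_on r {1..3}" "croots f = r ` {1..3}"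
proof -
  have "\<not> constant (poly (map_poly of_rat f :: complex poly))"
    using degree_f by (simp add: constant_degree degree_map_poly)
  then obtain s where s: "qeval f s = 0"
    using fundamental_theorem_of_algebra unfolding qeval_def by blast
  let ?g = "[:s\<^sup>2 + of_rat a * s + of_rat b, of_rat a + s, 1:] :: complex poly"
  have "\<not> constant (poly ?g)" by (simp add: constant_degree)
  then obtain t where "poly ?g t = 0"
    using fundamental_theorem_of_algebra by blast
  then have t: "t\<^sup>2 + (of_rat a + s) * t + (s\<^sup>2 + of_rat a * s + of_rat b) = 0"
    by (simp add: power2_eq_square algebra_simps)
  define u where "u = - of_rat a - s - t"
  have fac: "qeval f z = (z - s) * (z - t) * (z - u)" for z
    using factorization_at_roots[OF s t] unfolding u_def .
  have "cubic_disc a b c \<noteq> 0" using nonsquare[of 0] by auto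
  then have "(of_rat (cubic_disc a b c) :: complex) \<noteq> 0" by simp
  then have "cubic_disc (of_rat a) (of_rat b) (of_rat c) \<noteq> (0 :: complex)"
    unfolding cubic_disc_of_rat .
  moreover have "cubic_disc (of_rat a) (of_rat b) (of_rat c)
      = ((s - t) * (2 * s + t + of_rat a) * (2 * t + s + of_rat a))\<^sup>2"
    using t s unfolding qeval_f by (rule cubic_disc_roots)
  ultimately have "(s - t) * (2 * s + t + of_rat a) * (2 * t + s + of_rat a) \<noteq> 0" by auto
  moreover have "2 * s + t + of_rat a = s - u" "2 * t + s + of_rat a = t - u"
    by (simp_all add: u_def)
  ultimately have ne: "s \<noteq> t" "s \<noteq> u" "t \<noteq> u" by auto
  define r where "r = (\<lambda>i::nat. if i = 1 then s else if i = 2 then t else u)"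
  have A: "{1..3} = {1, 2, 3::nat}" by auto
  have "inj_on r {1..3}" using ne unfolding A by (auto simp: inj_on_def r_def)
  moreover have "croots f = r ` {1..3}" unfolding A croots_f fac by (auto simp: r_def)
  ultimately show ?thesis using that by blast
qed

lemma gal_root:
  assumes "\<sigma> \<in> gal_auts f" "x \<in> croots f"
  shows "\<sigma> x \<in> croots f"
proof -
  have "x \<in> splitting_field f" using assms(2) croots_subset_splitting_field by blast
  then have "qeval f (\<sigma> x) = \<sigma> (qeval f x)" by (simp add: gal_qeval[OF assms(1)])
  also have "\<dots> = \<sigma> (qeval 0 x)" using assms(2) by (simp add: croots_f)
  also have "\<dots> = 0" using \<open>x \<in> splitting_field f\<close> by (subst gal_qeval[OF assms(1)]) simp_all
  finally show ?thesis by (simp add: croots_f)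
qed

text \<open>Labelling the roots by 1, 2, 3 turns automorphisms into permutations. Two roots
  determine an automorphism, which gives injectivity; \<open>root_map\<close> realizes every choice
  of images for roots 1 and 2, and the sum of the roots then fixes the image of root 3.\<close>

theorem galois_group_iso: "galois_group f \<cong> sym_group 3"
proof -
  let ?A = "{1..3::nat}" and ?K = "splitting_field f"
  obtain r where r: "inj_on r ?A" and roots: "croots f = r ` ?A" by (rule obtain_roots)
  have rp: "root_pair (r i) (r j)" if "i \<in> ?A" "j \<in> ?A" "i \<noteq> j" for i j
    using that r roots unfolding root_pair_def by (auto simp: croots_f inj_on_def)
  have rK: "r i \<in> ?K" if "i \<in> ?A" for i
    using that roots croots_subset_splitting_field by blast
  \<comment> \<open>The identity outside {1, 2, 3} is what \<open>permutes\<close> demands.\<close>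
  define h where "h = (\<lambda>\<sigma> i. if i \<in> ?A then inv_into ?A r (\<sigma> (r i)) else i)"
  have h_in: "h \<sigma> i \<in> ?A" and r_h: "r (h \<sigma> i) = \<sigma> (r i)" if "\<sigma> \<in> gal_auts f" "i \<in> ?A" for \<sigma> i
  proof -
    have "\<sigma> (r i) \<in> r ` ?A" using gal_root[OF that(1), of "r i"] roots that(2) by blast
    then show "h \<sigma> i \<in> ?A" "r (h \<sigma> i) = \<sigma> (r i)"
      using that(2) unfolding h_def by (auto simp: inv_into_into f_inv_into_f simp del: atLeastAtMost_iff)
  qed
  have perm: "h \<sigma> permutes ?A" if \<sigma>: "\<sigma> \<in> gal_auts f" for \<sigma>
  proof (rule bij_imp_permutes)
    have "inj_on (h \<sigma>) ?A"
    proof (rule inj_onI)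
      fix i j assume ij: "i \<in> ?A" "j \<in> ?A" "h \<sigma> i = h \<sigma> j"
      then have "\<sigma> (r i) = \<sigma> (r j)" using r_h[OF \<sigma>] by metis
      moreover have "inj_on \<sigma> ?K" using \<sigma> by (auto simp: gal_auts_def bij_betw_def)
      ultimately have "r i = r j" using ij rK by (meson inj_onD)
      then show "i = j" using r ij by (meson inj_onD)
    qed
    moreover have "h \<sigma> ` ?A \<subseteq> ?A" using h_in[OF \<sigma>] by blast
    ultimately show "bij_betw (h \<sigma>) ?A ?A"
      by (simp add: bij_betw_def endo_inj_surj)
  qed (auto simp: h_def)
  have gal_K: "\<sigma> x \<in> ?K" if "\<sigma> \<in> gal_auts f" "x \<in> ?K" for \<sigma> x
    using that by (auto simp: gal_auts_def bij_betw_def)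
  have comp: "h (compose ?K \<sigma> \<tau>) = h \<sigma> \<circ> h \<tau>"
    if \<sigma>: "\<sigma> \<in> gal_auts f" and \<tau>: "\<tau> \<in> gal_auts f" for \<sigma> \<tau>
  proof
    fix i
    show "h (compose ?K \<sigma> \<tau>) i = (h \<sigma> \<circ> h \<tau>) i"
    proof (cases "i \<in> ?A")
      case True
      then show ?thesis
        using r_h[OF \<tau> True] h_in[OF \<tau> True] rK[OF True] by (simp add: h_def compose_def)
    qed (auto simp: h_def)
  qed
  have "h \<in> iso (galois_group f) (sym_group 3)"
  proof (rule isoI)
    show "h \<in> hom (galois_group f) (sym_group 3)"
    proof (rule homI)
      fix \<sigma> \<tau>
      assume "\<sigma> \<in> carrier (galois_group f)"
      then have \<sigma>: "\<sigma> \<in> gal_auts f" by (simp add: galois_group_def)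
      show "h \<sigma> \<in> carrier (sym_group 3)"
        using perm[OF \<sigma>] by (simp add: sym_group_def)
      assume "\<tau> \<in> carrier (galois_group f)"
      then have "\<tau> \<in> gal_auts f" by (simp add: galois_group_def)
      then show "h (\<sigma> \<otimes>\<^bsub>galois_group f\<^esub> \<tau>) = h \<sigma> \<otimes>\<^bsub>sym_group 3\<^esub> h \<tau>"
        using comp[OF \<sigma>] by (simp add: galois_group_def sym_group_def)
    qed
    have "inj_on h (gal_auts f)"
    proof (rule inj_onI)
      fix \<sigma> \<tau> assume \<sigma>: "\<sigma> \<in> gal_auts f" and \<tau>: "\<tau> \<in> gal_auts f" and eq: "h \<sigma> = h \<tau>"
      show "\<sigma> = \<tau>"
        by (rule gal_eqI[OF \<sigma> \<tau> rp[of 1 2]]) (use r_h[OF \<sigma>] r_h[OF \<tau>] eq in auto)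
    qed
    moreover have "\<exists>\<sigma>\<in>gal_auts f. h \<sigma> = \<pi>" if \<pi>: "\<pi> permutes ?A" for \<pi>
    proof -
      have \<pi>A: "\<pi> i \<in> ?A" if "i \<in> ?A" for i using that \<pi> permutes_in_image by metis
      have \<pi>ne: "\<pi> i \<noteq> \<pi> j" if "i \<noteq> j" for i j using that \<pi> by (metis permutes_inj injD)
      have p12: "root_pair (r 1) (r 2)" by (rule rp) auto
      have p12': "root_pair (r (\<pi> 1)) (r (\<pi> 2))" by (rule rp) (use \<pi>A \<pi>ne in auto)
      define \<sigma> where "\<sigma> = root_map (r 1) (r 2) (r (\<pi> 1)) (r (\<pi> 2))"
      have \<sigma>: "\<sigma> \<in> gal_auts f" unfolding \<sigma>_def by (rule root_map_gal[OF p12 p12'])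
      have third: "r k = - of_rat a - r i - r j"
        if "i \<in> ?A" "j \<in> ?A" "k \<in> ?A" "i \<noteq> j" "k \<noteq> i" "k \<noteq> j" for i j k
      proof -
        have "qeval f (r k) = 0" using that roots croots_f by blast
        moreover have "r k \<noteq> r i" "r k \<noteq> r j" using that r by (auto simp: inj_on_def)
        ultimately show ?thesis using third_root[OF rp[OF that(1,2,4)]] by blast
      qed
      have "r 3 = - of_rat a - r 1 - r 2"
        "r (\<pi> 3) = - of_rat a - r (\<pi> 1) - r (\<pi> 2)"
        by (rule third; use \<pi>A \<pi>ne in simp)+
      moreover have "\<sigma> (- of_rat a - r 1 - r 2) = - of_rat a - r (\<pi> 1) - r (\<pi> 2)"
        using root_map_lin'[OF p12 p12', of "([:- a, -1:], -1)"]
        by (simp add: \<sigma>_def lin_def of_rat_minus)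
      moreover have "\<sigma> (r 1) = r (\<pi> 1)" "\<sigma> (r 2) = r (\<pi> 2)"
        using root_map_lin'[OF p12 p12', of "([:0, 1:], 0)"] root_map_lin'[OF p12 p12', of "(0, 1)"]
        by (simp_all add: \<sigma>_def lin_def)
      ultimately have \<sigma>r: "\<sigma> (r i) = r (\<pi> i)" if "i \<in> ?A" for i
      proof -
        have "i = 1 \<or> i = 2 \<or> i = 3" using that by auto
        then show ?thesis using \<open>\<sigma> (r 1) = r (\<pi> 1)\<close> \<open>\<sigma> (r 2) = r (\<pi> 2)\<close>
            \<open>r 3 = _\<close> \<open>r (\<pi> 3) = _\<close> \<open>\<sigma> (- of_rat a - r 1 - r 2) = _\<close> by auto
      qed
      have "h \<sigma> i = \<pi> i" for i
      proof (cases "i \<in> ?A")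
        case True
        then show ?thesis
          using \<sigma>r[OF True] \<pi>A[OF True] r by (simp add: h_def del: atLeastAtMost_iff)
      next
        case False
        then show ?thesis using \<pi> by (simp add: h_def permutes_not_in del: atLeastAtMost_iff)
      qed
      then show ?thesis using \<sigma> by blast
    qed
    then have "h ` gal_auts f = {\<pi>. \<pi> permutes ?A}" using perm by blast
    ultimately show "bij_betw h (carrier (galois_group f)) (carrier (sym_group 3))"
      by (simp add: galois_group_def sym_group_def bij_betw_def)
  qed
  then show ?thesis by (auto simp: is_iso_def)
qed

end

section \<open>From rational to integral square discriminants\<close>

lemma rat_square_int:
  fixes q :: rat
  assumes "q\<^sup>2 = of_int D"
  shows "\<exists>Y::int. Y\<^sup>2 = D"
proof -
  obtain m n where q: "quotient_of q = (m, n)" by (cases "quotient_of q")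
  have n: "n > 0" and cop: "coprime m n" and div: "q = of_int m / of_int n"
    using quotient_of_denom_pos[OF q] quotient_of_coprime[OF q] quotient_of_div[OF q] by auto
  have nz: "(of_int n)\<^sup>2 \<noteq> (0 :: rat)" using n by simp
  have "(of_int m)\<^sup>2 / (of_int n)\<^sup>2 = (of_int D :: rat)"
    using assms by (simp only: div power_divide)
  then have "(of_int m)\<^sup>2 = (of_int D * (of_int n)\<^sup>2 :: rat)"
    by (simp only: nonzero_divide_eq_eq[OF nz])
  then have "(of_int (m\<^sup>2) :: rat) = of_int (D * n\<^sup>2)" by (simp only: of_int_power of_int_mult)
  then have eq: "m\<^sup>2 = D * n\<^sup>2" by (simp only: of_int_eq_iff)
  then have "n\<^sup>2 dvd m\<^sup>2" by simp
  then have "n dvd m" by simp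
  then have "n dvd 1" by (rule coprime_common_divisor[OF cop _ dvd_refl])
  then have "n = 1" using n by simp
  then show ?thesis using eq by auto
qed

lemma non_S3_imp_square_disc:
  fixes a b c :: int
  assumes "irreducible [:of_int c, of_int b, of_int a, 1 :: rat:]"
    and "\<not> galois_group [:of_int c, of_int b, of_int a, 1 :: rat:] \<cong> sym_group 3"
  shows "\<exists>Y. Y\<^sup>2 = cubic_disc a b c"
proof (rule ccontr)
  assume "\<not> ?thesis"
  moreover have "(of_int (cubic_disc a b c) :: rat) = cubic_disc (of_int a) (of_int b) (of_int c)"
    by (simp add: cubic_disc_def)
  ultimately have "q\<^sup>2 \<noteq> cubic_disc (of_int a) (of_int b) (of_int c)" for q :: rat
    using rat_square_int by metis
  with assms(1) have "nonsquare_cubic (of_int a) (of_int b) (of_int c)"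
    by (rule nonsquare_cubic.intro)
  then show False using assms(2) nonsquare_cubic.galois_group_iso by blast
qed

section \<open>Lattice points in strips\<close>

definition om :: complex where "om = Complex (-1/2) (sqrt 3 / 2)"

definition emb :: "eis \<Rightarrow> complex" where
  "emb z = of_int (cx z) + of_int (cy z) * om"

lemma om_sq: "om * om = - 1 - om"
  by (simp add: om_def complex_eq_iff)

lemma om_cube: "om ^ 3 = 1"
  by (simp add: om_def complex_eq_iff power3_eq_cube)

lemma norm_om [simp]: "cmod om = 1"
  by (simp add: om_def cmod_def power2_eq_square)

lemma emb_mult: "emb (x * y) = emb x * emb y"
proof -
  have "emb x * emb y = of_int (cx x * cx y) + of_int (cx x * cy y + cy x * cx y) * om
      + of_int (cy x * cy y) * (om * om)"
    by (simp add: emb_def algebra_simps)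
  then show ?thesis by (simp add: om_sq emb_def algebra_simps)
qed

lemma emb_of_int [simp]: "emb (of_int k) = of_int k"
  by (simp add: emb_def)

lemma emb_power: "emb (x ^ n) = emb x ^ n"
  by (induction n) (simp_all add: emb_mult, simp add: emb_def)

lemma cmod_emb: "(cmod (emb z))\<^sup>2 = of_int (enorm z)"
  unfolding cmod_power2 by (simp add: emb_def om_def enorm_def power2_eq_square algebra_simps)

lemma Im_emb: "Im (emb z) = of_int (cy z) * (sqrt 3 / 2)"
  by (simp add: emb_def om_def)

section \<open>Counting integers in intervals and pairs over a base\<close>

lemma card_int_interval:
  fixes lo hi :: real
  assumes "lo \<le> hi"
  shows "finite {k::int. lo \<le> k \<and> k \<le> hi}" "card {k::int. lo \<le> k \<and> k \<le> hi} \<le> hi - lo + 1"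
proof -
  have eq: "{k::int. lo \<le> k \<and> k \<le> hi} = {\<lceil>lo\<rceil>..\<lfloor>hi\<rfloor>}"
    by (auto simp: le_floor_iff ceiling_le_iff)
  show "finite {k::int. lo \<le> k \<and> k \<le> hi}" by (simp add: eq)
  have "real_of_int (\<lfloor>hi\<rfloor> + 1 - \<lceil>lo\<rceil>) \<le> hi + 1 - lo" by linarith
  then show "card {k::int. lo \<le> k \<and> k \<le> hi} \<le> hi - lo + 1"
    using assms unfolding eq by (simp add: of_nat_nat nat_le_iff)
qed

lemma card_abs_interval:
  fixes d m :: real
  assumes "d \<ge> 0"
  shows "finite {k::int. \<bar>k - m\<bar> \<le> d}" "card {k::int. \<bar>k - m\<bar> \<le> d} \<le> 2 * d + 1"
proof -
  have eq: "{k::int. \<bar>k - m\<bar> \<le> d} = {k. m - d \<le> k \<and> k \<le> m + d}" by (auto simp: abs_le_iff)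
  show "finite {k::int. \<bar>k - m\<bar> \<le> d}" "card {k::int. \<bar>k - m\<bar> \<le> d} \<le> 2 * d + 1"
    using card_int_interval[of "m - d" "m + d"] assms unfolding eq by auto
qed

lemma card_le_diameter:
  fixes B :: "int set" and d :: real
  assumes "d \<ge> 0" "\<And>x y. x \<in> B \<Longrightarrow> y \<in> B \<Longrightarrow> \<bar>x - y\<bar> \<le> d"
  shows "finite B" "card B \<le> 2 * d + 1"
proof -
  have "finite B \<and> card B \<le> 2 * d + 1"
  proof (cases "B = {}")
    case False
    then obtain m where m: "m \<in> B" by blast
    have sub: "B \<subseteq> {k::int. \<bar>k - real_of_int m\<bar> \<le> d}"
      using assms(2)[OF _ m] by auto
    then have "finite B" using card_abs_interval(1)[OF assms(1)] by (rule finite_subset)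
    moreover have "card B \<le> card {k::int. \<bar>k - real_of_int m\<bar> \<le> d}"
      using sub card_abs_interval(1)[OF assms(1)] by (intro card_mono)
    ultimately show ?thesis using card_abs_interval(2)[OF assms(1), of m] by linarith
  qed (use assms(1) in simp)
  then show "finite B" "card B \<le> 2 * d + 1" by auto
qed

lemma card_Sigma_le:
  fixes c :: real
  assumes "finite A" "\<And>x. x \<in> A \<Longrightarrow> finite (B x)" "\<And>x. x \<in> A \<Longrightarrow> card (B x) \<le> c"
  shows "finite (Sigma A B)" "card (Sigma A B) \<le> card A * c"
proof -
  show "finite (Sigma A B)" using assms by auto
  have "real (card (Sigma A B)) = (\<Sum>x\<in>A. real (card (B x)))" using assms by simp
  also have "\<dots> \<le> of_nat (card A) * c" using assms(3) by (rule sum_bounded_above)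
  finally show "card (Sigma A B) \<le> card A * c" .
qed

text \<open>For each x the linear condition confines y to an interval of radius V/|q|, so the points
  are counted by fibres over x.\<close>

lemma card_strip_coordinates:
  fixes p q V X :: real
  assumes "q \<noteq> 0" "V \<ge> 0" "X \<ge> 0"
  defines "A \<equiv> {(x::int, y::int). \<bar>x\<bar> \<le> X \<and> \<bar>x * p + y * q\<bar> \<le> V}"
  shows "finite A" "card A \<le> (2 * X + 1) * (2 * (V / \<bar>q\<bar>) + 1)"
proof -
  define F where "F = (\<lambda>x::int. {y::int. \<bar>y - (- (x * p / q))\<bar> \<le> V / \<bar>q\<bar>})"
  define X' where "X' = {x::int. \<bar>x - (0::real)\<bar> \<le> X}"
  have "\<bar>y - (- (x * p / q))\<bar> \<le> V / \<bar>q\<bar> \<longleftrightarrow> \<bar>x * p + y * q\<bar> \<le> V" for x y :: int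
  proof -
    have "y - (- (x * p / q)) = (x * p + y * q) / q" using assms(1) by (simp add: add_divide_distrib)
    then show ?thesis using assms(1) by (simp only: abs_divide divide_le_cancel) auto
  qed
  then have A: "A = Sigma X' F" unfolding A_def F_def X'_def by auto
  have V: "0 \<le> V / \<bar>q\<bar>" using assms by simp
  have X: "finite X'" "card X' \<le> 2 * X + 1"
    unfolding X'_def by (rule card_abs_interval[OF assms(3)])+
  have F: "finite (F x)" "card (F x) \<le> 2 * (V / \<bar>q\<bar>) + 1" for x
    unfolding F_def by (rule card_abs_interval[OF V])+
  show "finite A" unfolding A by (rule card_Sigma_le(1)[OF X(1) F])
  have "card A \<le> card X' * (2 * (V / \<bar>q\<bar>) + 1)"
    unfolding A by (rule card_Sigma_le(2)[OF X(1) F])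
  also have "\<dots> \<le> (2 * X + 1) * (2 * (V / \<bar>q\<bar>) + 1)"
    using X(2) V by (intro mult_right_mono) auto
  finally show "card A \<le> (2 * X + 1) * (2 * (V / \<bar>q\<bar>) + 1)" .
qed

text \<open>Four times the norm is at least three times the square of either coordinate; the
  resulting factor 2/sqrt 3 is rounded up to 2.\<close>

lemma eis_coords_le:
  fixes T :: real
  assumes "enorm z \<le> T\<^sup>2" "T \<ge> 0"
  shows "\<bar>cx z\<bar> \<le> 2 * T" "\<bar>cy z\<bar> \<le> 2 * T"
proof -
  have "real_of_int (3 * (cy z)\<^sup>2) \<le> real_of_int (4 * enorm z)"
    unfolding of_int_le_iff four_enorm by simp
  moreover have "real_of_int (3 * (cx z)\<^sup>2) \<le> real_of_int (4 * enorm z)"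
    unfolding of_int_le_iff four_enorm' by simp
  ultimately have "3 * (real_of_int (cy z))\<^sup>2 \<le> 4 * real_of_int (enorm z)"
    "3 * (real_of_int (cx z))\<^sup>2 \<le> 4 * real_of_int (enorm z)"
    by (simp_all only: of_int_mult of_int_power of_int_numeral)
  then have "(real_of_int (cy z))\<^sup>2 \<le> (2 * T)\<^sup>2" "(real_of_int (cx z))\<^sup>2 \<le> (2 * T)\<^sup>2"
    using assms zero_le_power2[of T] unfolding power_mult_distrib by (simp, linarith)+
  then have "\<bar>real_of_int (cy z)\<bar> \<le> \<bar>2 * T\<bar>" "\<bar>real_of_int (cx z)\<bar> \<le> \<bar>2 * T\<bar>"
    by (simp_all only: abs_le_square_iff)
  then show "\<bar>cx z\<bar> \<le> 2 * T" "\<bar>cy z\<bar> \<le> 2 * T"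
    using assms(2) by simp_all
qed

lemma card_eis_ball:
  fixes T :: real
  assumes "T \<ge> 0"
  shows "finite {z. enorm z \<le> T\<^sup>2}" "card {z. enorm z \<le> T\<^sup>2} \<le> (4 * T + 1)\<^sup>2"
proof -
  let ?X = "{x::int. \<bar>x - (0::real)\<bar> \<le> 2 * T}"
  have X: "finite ?X" "card ?X \<le> 2 * (2 * T) + 1"
    using card_abs_interval[of "2 * T" 0] assms by auto
  have sub: "{z. enorm z \<le> T\<^sup>2} \<subseteq> (\<lambda>(x, y). Eis x y) ` (?X \<times> ?X)"
  proof
    fix z assume "z \<in> {z. enorm z \<le> T\<^sup>2}"
    then have "\<bar>cx z\<bar> \<le> 2 * T" "\<bar>cy z\<bar> \<le> 2 * T" using eis_coords_le assms by auto
    then show "z \<in> (\<lambda>(x, y). Eis x y) ` (?X \<times> ?X)"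
      by (intro image_eqI[of _ _ "(cx z, cy z)"]) (auto simp: eis_eq_iff)
  qed
  then show "finite {z. enorm z \<le> T\<^sup>2}" using X(1) by (meson finite_SigmaI finite_imageI finite_subset)
  have "card {z. enorm z \<le> T\<^sup>2} \<le> card (?X \<times> ?X)"
    using surj_card_le[OF _ sub] X(1) by simp
  then have "real (card {z. enorm z \<le> T\<^sup>2}) \<le> card (?X \<times> ?X)" by simp
  also have "real (card (?X \<times> ?X)) = real (card ?X) * real (card ?X)"
    by (simp add: card_cartesian_product)
  also have "\<dots> \<le> (4 * T + 1) * (4 * T + 1)" using X(2) by (intro mult_mono) auto
  finally show "card {z. enorm z \<le> T\<^sup>2} \<le> (4 * T + 1)\<^sup>2" by (simp add: power2_eq_square)
qed

lemma card_eis_ball_double: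
  fixes T :: real
  assumes "T \<ge> 1"
  shows "finite {z. enorm z \<le> (2 * T)\<^sup>2}" "card {z. enorm z \<le> (2 * T)\<^sup>2} \<le> 81 * T\<^sup>2"
proof -
  have T: "0 \<le> 2 * T" using assms by simp
  show "finite {z. enorm z \<le> (2 * T)\<^sup>2}" by (rule card_eis_ball(1)[OF T])
  have "card {z. enorm z \<le> (2 * T)\<^sup>2} \<le> (4 * (2 * T) + 1)\<^sup>2" by (rule card_eis_ball(2)[OF T])
  also have "\<dots> \<le> (9 * T)\<^sup>2" using assms by (intro power_mono) auto
  finally show "card {z. enorm z \<le> (2 * T)\<^sup>2} \<le> 81 * T\<^sup>2" by (simp add: power_mult_distrib)
qed

text \<open>The strip condition is |xp + yq| \<le> V in the coordinates x, y of z, with p = Im g and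
  q = Im (g * \<open>om\<close>). The identity 3|g|^2 = 4(p^2 + pq + q^2) forces |p| or |q| to be at
  least |g|/2, so solving for the coordinate with that coefficient gives an interval of radius at
  most 2W.\<close>

lemma card_eis_strip:
  fixes g :: complex and T W :: real
  assumes g: "g \<noteq> 0" and T: "T \<ge> 0" and W: "W \<ge> 0"
  defines "A \<equiv> {z. enorm z \<le> T\<^sup>2 \<and> \<bar>Im (g * emb z)\<bar> \<le> W * cmod g}"
  shows "finite A" "card A \<le> (4 * T + 1) * (4 * W + 1)"
proof -
  define p q V where "p = Im g" and "q = Im (g * om)" and "V = W * cmod g"
  have V: "V \<ge> 0" using W by (simp add: V_def)
  have Im: "Im (g * emb z) = cx z * p + cy z * q" for z
    by (simp add: emb_def p_def q_def algebra_simps)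
  have mem: "\<bar>real_of_int (cx z)\<bar> \<le> 2 * T" "\<bar>real_of_int (cy z)\<bar> \<le> 2 * T"
    "\<bar>cx z * p + cy z * q\<bar> \<le> V" if "z \<in> A" for z
    using that eis_coords_le[OF _ T, of z] unfolding A_def mem_Collect_eq Im V_def by auto
  have "finite A"
    by (rule finite_subset[OF _ card_eis_ball(1)[OF T]]) (auto simp: A_def)
  \<comment> \<open>Both cases are treated at once: \<open>v\<close> is the large coefficient and
    \<open>k\<close> lists the coordinates of z with the one multiplied by \<open>v\<close>
    last.\<close>
  have two: "card A \<le> (4 * T + 1) * (4 * W + 1)"
    if "cmod g \<le> 2 * \<bar>v\<bar>" and inj: "\<And>z z'. k z = k z' \<Longrightarrow> z = z'"
      and k: "\<And>z. z \<in> A \<Longrightarrow> \<bar>fst (k z)\<bar> \<le> 2 * T \<and> \<bar>fst (k z) * u + snd (k z) * v\<bar> \<le> V"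
    for u v :: real and k :: "eis \<Rightarrow> int \<times> int"
  proof -
    let ?B = "{(x::int, y::int). \<bar>x\<bar> \<le> 2 * T \<and> \<bar>x * u + y * v\<bar> \<le> V}"
    have v: "v \<noteq> 0" using that(1) g by auto
    have T2: "0 \<le> 2 * T" using T by simp
    note B = card_strip_coordinates[OF v V T2, of u]
    have "card A \<le> card ?B"
      by (rule card_inj_on_le[of k]) (use inj k B(1) in \<open>auto simp: inj_on_def case_prod_unfold\<close>)
    then have "real (card A) \<le> card ?B" by simp
    also have "card ?B \<le> (2 * (2 * T) + 1) * (2 * (V / \<bar>v\<bar>) + 1)" using B(2) by simp
    also have "(2 * (2 * T) + 1) * (2 * (V / \<bar>v\<bar>) + 1) \<le> (4 * T + 1) * (4 * W + 1)"
    proof -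
      have "V / \<bar>v\<bar> \<le> 2 * W"
        using mult_left_mono[OF that(1) W] v by (simp add: V_def divide_le_eq mult_ac)
      then show ?thesis
        using T V by (intro mult_mono) auto
    qed
    finally show ?thesis .
  qed
  have "q = (sqrt 3 * Re g - p) / 2" by (simp add: q_def p_def om_def)
  then have "2 * q + p = sqrt 3 * Re g" by simp
  then have "(2 * q + p)\<^sup>2 = 3 * (Re g)\<^sup>2" by (simp add: power_mult_distrib)
  then have "3 * (cmod g)\<^sup>2 = (2 * q + p)\<^sup>2 + 3 * p\<^sup>2"
    by (simp add: cmod_power2 p_def)
  also have "\<dots> = 4 * (p\<^sup>2 + p * q + q\<^sup>2)"
    by (simp add: power2_eq_square algebra_simps)
  finally have gn: "3 * (cmod g)\<^sup>2 = 4 * (p\<^sup>2 + p * q + q\<^sup>2)" .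
  have "cmod g \<le> 2 * \<bar>p\<bar> \<or> cmod g \<le> 2 * \<bar>q\<bar>"
  proof (rule ccontr)
    assume "\<not> ?thesis"
    then have "(2 * \<bar>p\<bar>)\<^sup>2 < (cmod g)\<^sup>2" "(2 * \<bar>q\<bar>)\<^sup>2 < (cmod g)\<^sup>2"
      by (intro power_strict_mono; simp)+
    moreover have "2 * (p * q) \<le> p\<^sup>2 + q\<^sup>2" using sum_squares_bound[of p q] by simp
    ultimately show False using gn by (simp add: power_mult_distrib)
  qed
  then have "card A \<le> (4 * T + 1) * (4 * W + 1)"
  proof
    assume "cmod g \<le> 2 * \<bar>q\<bar>"
    then show ?thesis
      by (rule two[where k = "\<lambda>z. (cx z, cy z)" and u = p])
        (use mem in \<open>auto simp: eis_eq_iff\<close>)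
  next
    assume "cmod g \<le> 2 * \<bar>p\<bar>"
    then show ?thesis
      by (rule two[where k = "\<lambda>z. (cy z, cx z)" and u = q])
        (use mem in \<open>auto simp: eis_eq_iff add.commute\<close>)
  qed
  with \<open>finite A\<close> show "finite A" "card A \<le> (4 * T + 1) * (4 * W + 1)" by simp_all
qed

text \<open>The imaginary part of the cube is four times the product of the imaginary parts of the
  three rotations, and the two larger factors are comparable to the modulus.\<close>

lemma Im_cube_rotation:
  fixes z :: complex
  shows "\<exists>i<3. \<bar>Im (om ^ i * z)\<bar> * (cmod z)\<^sup>2 \<le> \<bar>Im (z ^ 3)\<bar>"
proof -
  define x y where "x = Re z" and "y = Im z"
  have n: "(cmod z)\<^sup>2 = x\<^sup>2 + y\<^sup>2" by (simp add: cmod_power2 x_def y_def)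
  have I3: "Im (z ^ 3) = y * (3 * x\<^sup>2 - y\<^sup>2)"
    by (simp add: power3_eq_cube x_def y_def power2_eq_square algebra_simps)
  have I1: "Im (om ^ 1 * z) = (sqrt 3 * x - y) / 2" by (simp add: om_def x_def y_def)
  have I2: "Im (om ^ 2 * z) = - (sqrt 3 * x + y) / 2"
    unfolding power2_eq_square om_sq by (simp add: om_def x_def y_def)
  show ?thesis
  proof (cases "\<bar>y\<bar> \<le> \<bar>x\<bar>")
    case True
    then have "y\<^sup>2 \<le> x\<^sup>2" by (simp add: abs_le_square_iff)
    \<comment> \<open>For |y| \<le> |x| the unrotated z itself serves, as the remaining factor of
      the cube is at least |z|^2.\<close>
    then have "x\<^sup>2 + y\<^sup>2 \<le> \<bar>3 * x\<^sup>2 - y\<^sup>2\<bar>" by linarith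
    then have "\<bar>y\<bar> * (x\<^sup>2 + y\<^sup>2) \<le> \<bar>y\<bar> * \<bar>3 * x\<^sup>2 - y\<^sup>2\<bar>" by (intro mult_left_mono) auto
    then have "\<bar>Im (om ^ 0 * z)\<bar> * (cmod z)\<^sup>2 \<le> \<bar>Im (z ^ 3)\<bar>"
      unfolding I3 n abs_mult by (simp add: y_def)
    then show ?thesis by (intro exI[of _ 0]) simp
  next
    case False
    then have xy: "x\<^sup>2 \<le> y\<^sup>2" using abs_le_square_iff[of x y] by simp
    define u where "u = \<bar>sqrt 3 * \<bar>x\<bar> - \<bar>y\<bar>\<bar>"
    have u: "u \<ge> 0" by (simp add: u_def)
    have "3 * x\<^sup>2 - y\<^sup>2 = (sqrt 3 * \<bar>x\<bar> + \<bar>y\<bar>) * (sqrt 3 * \<bar>x\<bar> - \<bar>y\<bar>)"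
      by (simp add: algebra_simps power2_eq_square)
    then have cube: "\<bar>Im (z ^ 3)\<bar> = \<bar>y\<bar> * (sqrt 3 * \<bar>x\<bar> + \<bar>y\<bar>) * u"
      unfolding I3 abs_mult u_def by (simp add: abs_mult)
    have half: "(x\<^sup>2 + y\<^sup>2) / 2 \<le> \<bar>y\<bar> * (sqrt 3 * \<bar>x\<bar> + \<bar>y\<bar>)"
    proof -
      have "(x\<^sup>2 + y\<^sup>2) / 2 \<le> \<bar>y\<bar> * \<bar>y\<bar>" using xy by (simp add: power2_eq_square)
      also have "\<dots> \<le> \<bar>y\<bar> * (sqrt 3 * \<bar>x\<bar> + \<bar>y\<bar>)" by (intro mult_left_mono) auto
      finally show ?thesis .
    qed
    have le: "u / 2 * (cmod z)\<^sup>2 \<le> \<bar>Im (z ^ 3)\<bar>"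
      using mult_right_mono[OF half u] unfolding n cube by (simp add: mult.commute)
    define w where "w = sqrt 3 * \<bar>x\<bar> - \<bar>y\<bar>"
    \<comment> \<open>According to the signs of x and y, one of the two nontrivial rotations has
      imaginary part u/2 in absolute value.\<close>
    have "sqrt 3 * x - y = w \<or> sqrt 3 * x - y = - w \<or> sqrt 3 * x + y = w \<or> sqrt 3 * x + y = - w"
      unfolding w_def by (cases "x \<ge> 0"; cases "y \<ge> 0"; simp)
    then have "\<bar>sqrt 3 * x - y\<bar> = u \<or> \<bar>sqrt 3 * x + y\<bar> = u"
      unfolding u_def w_def[symmetric] by (elim disjE) simp_all
    then have "\<bar>Im (om ^ 1 * z)\<bar> = u / 2 \<or> \<bar>Im (om ^ 2 * z)\<bar> = u / 2"
      unfolding I1 I2 abs_divide abs_minus_cancel by simp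
    then show ?thesis
    proof
      assume e: "\<bar>Im (om ^ 1 * z)\<bar> = u / 2"
      have "\<bar>Im (om ^ 1 * z)\<bar> * (cmod z)\<^sup>2 \<le> \<bar>Im (z ^ 3)\<bar>" unfolding e by (rule le)
      moreover have "1 < (3::nat)" by simp
      ultimately show ?thesis by blast
    next
      assume e: "\<bar>Im (om ^ 2 * z)\<bar> = u / 2"
      have "\<bar>Im (om ^ 2 * z)\<bar> * (cmod z)\<^sup>2 \<le> \<bar>Im (z ^ 3)\<bar>" unfolding e by (rule le)
      moreover have "2 < (3::nat)" by simp
      ultimately show ?thesis by blast
    qed
  qed
qed

lemma complex_cube_root: "\<exists>\<rho>::complex. \<rho> ^ 3 = w"
proof -
  have "\<not> constant (poly [:- w, 0, 0, 1:])" by (simp add: constant_degree)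
  then obtain \<rho> where "poly [:- w, 0, 0, 1:] \<rho> = 0"
    using fundamental_theorem_of_algebra by blast
  then have "\<rho> ^ 3 = w" by (simp add: power3_eq_cube mult.assoc)
  then show ?thesis by blast
qed

section \<open>Counting cubics with square discriminant\<close>

text \<open>In the notation above, the last two equations say that \<open>\<xi>\<close> and \<open>\<gamma>\<close> yield \<open>J = tr \<alpha>\<close> and that the
  second coordinate of \<open>\<alpha>\<close> is \<open>\<plusminus>3Y\<close>.\<close>

definition param :: "real \<Rightarrow> (int \<times> eis \<times> eis) set" where
  "param H = {(a, \<xi>, \<gamma>). \<exists>b c. \<bar>real_of_int a\<bar> \<le> H \<and> \<bar>real_of_int b\<bar> \<le> H \<and> \<bar>real_of_int c\<bar> \<le> H
     \<and> a\<^sup>2 - 3 * b = enorm \<xi> * enorm \<gamma> \<and> enorm \<xi> * enorm \<gamma> > 0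
     \<and> 2 * cx (of_int (enorm \<xi>) * \<xi> * \<gamma> ^ 3) - cy (of_int (enorm \<xi>) * \<xi> * \<gamma> ^ 3)
         = 2 * a ^ 3 - 9 * a * b + 27 * c
     \<and> (cy (of_int (enorm \<xi>) * \<xi> * \<gamma> ^ 3))\<^sup>2 = 9 * cubic_disc a b c}"

section \<open>Size constraints on the parameters\<close>

lemma square_le_if_abs_le: "\<bar>x\<bar> \<le> y \<Longrightarrow> x\<^sup>2 \<le> y\<^sup>2" for x y :: real
  using power_mono[of "\<bar>x\<bar>" y 2] by simp

text \<open>Each of the first four monomials is at most A^2 H^2 up to its coefficient, and 27 = 1 +
  4 + 4 + 18; the last term is at most 0. The bound H \<le> A^2 handles B^3, and |A| \<le> A^2
  handles ABC.\<close>

lemma cubic_disc_le: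
  fixes A B C H :: real
  assumes "\<bar>A\<bar> \<le> H" "\<bar>B\<bar> \<le> H" "\<bar>C\<bar> \<le> H" "H \<le> A\<^sup>2" "1 \<le> \<bar>A\<bar>"
  shows "cubic_disc A B C \<le> 27 * (A\<^sup>2 * H\<^sup>2)"
proof -
  have H: "H \<ge> 0" using assms(1) by linarith
  have "A\<^sup>2 * B\<^sup>2 \<le> A\<^sup>2 * H\<^sup>2"
    using square_le_if_abs_le[OF assms(2)] by (intro mult_left_mono) auto
  moreover have "- (B ^ 3) \<le> A\<^sup>2 * H\<^sup>2"
  proof -
    have "- (B ^ 3) \<le> \<bar>B\<bar> ^ 3" by (simp add: power_abs[symmetric] abs_le_iff)
    also have "\<dots> \<le> H ^ 3" using assms(2) by (intro power_mono) auto
    also have "\<dots> = H * H\<^sup>2" by (simp add: power3_eq_cube power2_eq_square)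
    also have "\<dots> \<le> A\<^sup>2 * H\<^sup>2" using assms(4) by (intro mult_right_mono) auto
    finally show ?thesis .
  qed
  moreover have "- (A ^ 3 * C) \<le> A\<^sup>2 * H\<^sup>2"
  proof -
    have "- (A ^ 3 * C) \<le> \<bar>A ^ 3 * C\<bar>" by simp
    also have "\<dots> = \<bar>A\<bar>\<^sup>2 * (\<bar>A\<bar> * \<bar>C\<bar>)"
      by (simp only: abs_mult power_abs[symmetric] power2_eq_square power3_eq_cube mult.assoc)
    also have "\<dots> \<le> \<bar>A\<bar>\<^sup>2 * (H * H)" using assms H by (intro mult_left_mono mult_mono) auto
    finally show ?thesis by (simp add: power2_eq_square)
  qed
  moreover have "A * B * C \<le> A\<^sup>2 * H\<^sup>2"
  proof -
    have "A * B * C \<le> \<bar>A * B * C\<bar>" by simp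
    also have "\<dots> = \<bar>A\<bar> * (\<bar>B\<bar> * \<bar>C\<bar>)" by (simp add: abs_mult)
    also have "\<dots> \<le> (\<bar>A\<bar> * \<bar>A\<bar>) * (H * H)"
      using assms H mult_left_mono[OF assms(5), of "\<bar>A\<bar>"] by (intro mult_mono) auto
    finally show ?thesis by (simp add: power2_eq_square)
  qed
  ultimately show ?thesis unfolding cubic_disc_def using zero_le_power2[of C] by linarith
qed

lemma param_size:
  assumes "(a, \<xi>, \<gamma>) \<in> param H"
  shows "\<bar>real_of_int a\<bar> \<le> H"
    and "\<bar>(real_of_int a)\<^sup>2 - real_of_int (enorm \<xi>) * real_of_int (enorm \<gamma>)\<bar> \<le> 3 * H"
proof -
  obtain b where b: "\<bar>real_of_int a\<bar> \<le> H" "\<bar>real_of_int b\<bar> \<le> H" "a\<^sup>2 - 3 * b = enorm \<xi> * enorm \<gamma>"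
    using assms by (auto simp: param_def)
  show "\<bar>real_of_int a\<bar> \<le> H" by fact
  have "real_of_int (a\<^sup>2 - 3 * b) = real_of_int (enorm \<xi> * enorm \<gamma>)" using b(3) by simp
  then show "\<bar>(real_of_int a)\<^sup>2 - real_of_int (enorm \<xi>) * real_of_int (enorm \<gamma>)\<bar> \<le> 3 * H"
    using b(2) by (simp add: abs_le_iff)
qed

text \<open>The left side is |Im \<alpha>|, which is sqrt 3 / 2 times the size of the second
  coordinate of \<alpha>; the square of that coordinate is nine times the discriminant. The lower
  bound on a^2 makes \<open>cubic_disc_le\<close> applicable.\<close>

lemma param_angle:
  assumes par: "(a, \<xi>, \<gamma>) \<in> param H" and H: "H \<ge> 1" and a: "6 * H \<le> (real_of_int a)\<^sup>2"
  shows "\<bar>Im (emb \<xi> * emb \<gamma> ^ 3)\<bar> * real_of_int (enorm \<xi>) \<le> 14 * (\<bar>real_of_int a\<bar> * H)"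
proof -
  let ?\<alpha> = "of_int (enorm \<xi>) * \<xi> * \<gamma> ^ 3"
  obtain b c where bc: "\<bar>real_of_int a\<bar> \<le> H" "\<bar>real_of_int b\<bar> \<le> H" "\<bar>real_of_int c\<bar> \<le> H"
    "(cy ?\<alpha>)\<^sup>2 = 9 * cubic_disc a b c"
    using par unfolding param_def by auto
  have "a \<noteq> 0" using a H by auto
  then have "1 \<le> \<bar>real_of_int a\<bar>" by linarith
  then have D: "cubic_disc (real_of_int a) b c \<le> 27 * ((real_of_int a)\<^sup>2 * H\<^sup>2)"
    using bc a H by (intro cubic_disc_le) auto
  have "real_of_int ((cy ?\<alpha>)\<^sup>2) = real_of_int (9 * cubic_disc a b c)" using bc(4) by simp
  then have cy: "(real_of_int (cy ?\<alpha>))\<^sup>2 = 9 * cubic_disc (real_of_int a) b c"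
    by (simp add: cubic_disc_def)
  have "(Im (emb ?\<alpha>))\<^sup>2 = 3 / 4 * (real_of_int (cy ?\<alpha>))\<^sup>2"
    unfolding Im_emb by (simp add: power_mult_distrib power_divide)
  \<comment> \<open>The constant is 3/4 * 9 * 27 = 182.25, below 14^2 = 196.\<close>
  also have "\<dots> \<le> (14 * (\<bar>real_of_int a\<bar> * H))\<^sup>2"
  proof -
    have "(14 * (\<bar>real_of_int a\<bar> * H))\<^sup>2 = 196 * ((real_of_int a)\<^sup>2 * H\<^sup>2)"
      by (simp add: power_mult_distrib)
    moreover have "0 \<le> (real_of_int a)\<^sup>2 * H\<^sup>2" by simp
    ultimately show ?thesis using D unfolding cy by linarith
  qed
  finally have "\<bar>Im (emb ?\<alpha>)\<bar> \<le> \<bar>14 * (\<bar>real_of_int a\<bar> * H)\<bar>"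
    by (simp only: abs_le_square_iff)
  moreover have "Im (emb ?\<alpha>) = real_of_int (enorm \<xi>) * Im (emb \<xi> * emb \<gamma> ^ 3)"
  proof -
    have "Im (of_int k * w) = real_of_int k * Im w" for k w by simp
    moreover have "emb ?\<alpha> = of_int (enorm \<xi>) * (emb \<xi> * emb \<gamma> ^ 3)"
      by (simp add: emb_mult emb_power)
    ultimately show ?thesis by (simp only:)
  qed
  then have "\<bar>Im (emb ?\<alpha>)\<bar> = \<bar>Im (emb \<xi> * emb \<gamma> ^ 3)\<bar> * real_of_int (enorm \<xi>)"
    by (simp only: abs_mult mult.commute) simp
  moreover have "\<bar>14 * (\<bar>real_of_int a\<bar> * H)\<bar> = 14 * (\<bar>real_of_int a\<bar> * H)"
    using H by simp
  ultimately show ?thesis by (simp only:)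
qed

text \<open>Fix the member of the pair with the smaller size. For fixed \<gamma> the condition on
  \<xi> is a strip. For fixed \<xi> with cube root r the product is (r\<gamma>)^3, and
  \<open>Im_cube_rotation\<close> puts \<gamma> in one of three strips. The constant 2187 is 3 * 81
  * 9: rotations, points of the ball, length of the strip.\<close>

lemma card_pairs_small_imaginary_part:
  fixes R S K :: real
  assumes R: "R \<ge> 1" and S: "S \<ge> 1" and K: "K \<ge> 0"
  defines "P \<equiv> {(\<xi>, \<gamma>). R\<^sup>2 \<le> enorm \<xi> \<and> enorm \<xi> \<le> (2 * R)\<^sup>2 \<and> S\<^sup>2 \<le> enorm \<gamma> \<and> enorm \<gamma> \<le> (2 * S)\<^sup>2
    \<and> \<bar>Im (emb \<xi> * emb \<gamma> ^ 3)\<bar> \<le> K}"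
  shows "finite P" "card P \<le> 2187 * (4 * R * K / S + R * S * min R S)"
proof -
  note ball = card_eis_ball_double
  have norm_ge: "T \<le> cmod (emb z)" if "T \<ge> 1" "T\<^sup>2 \<le> enorm z" for T :: real and z
  proof (rule power2_le_imp_le)
    show "T\<^sup>2 \<le> (cmod (emb z))\<^sup>2" using that(2) by (simp only: cmod_emb)
  qed simp
  have fin: "finite P"
    by (rule finite_subset[OF _ finite_cartesian_product[OF ball(1)[OF R] ball(1)[OF S]]])
      (auto simp: P_def)
  have "card P \<le> 2187 * (4 * R * K / S + R * S * min R S)"
  proof (cases "S \<le> R")
    case True
    \<comment> \<open>Since |\<gamma>|^3 is at least S^3, K is at most W * |\<gamma>^3|, the form
      that \<open>card_eis_strip\<close> expects.\<close>
    define W where "W = K / S ^ 3"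
    have W: "W \<ge> 0" using K S by (simp add: W_def)
    define G where "G = {\<gamma>. S\<^sup>2 \<le> enorm \<gamma> \<and> enorm \<gamma> \<le> (2 * S)\<^sup>2}"
    define F where "F = (\<lambda>\<gamma>. {\<xi>. enorm \<xi> \<le> (2 * R)\<^sup>2
      \<and> \<bar>Im (emb \<gamma> ^ 3 * emb \<xi>)\<bar> \<le> W * cmod (emb \<gamma> ^ 3)})"
    have G: "finite G" "card G \<le> 81 * S\<^sup>2"
    proof -
      have sub: "G \<subseteq> {z. enorm z \<le> (2 * S)\<^sup>2}" by (auto simp: G_def)
      then show "finite G" using ball(1)[OF S] by (rule finite_subset)
      show "card G \<le> 81 * S\<^sup>2"
        using card_mono[OF ball(1)[OF S] sub] ball(2)[OF S] by linarith
    qed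
    have n: "S \<le> cmod (emb \<gamma>)" if "\<gamma> \<in> G" for \<gamma>
      using that norm_ge[OF S] by (simp add: G_def)
    have ne: "emb \<gamma> ^ 3 \<noteq> 0" if "\<gamma> \<in> G" for \<gamma>
      using n[OF that] S by auto
    have R2: "0 \<le> 2 * R" using R by simp
    have F: "finite (F \<gamma>)" "card (F \<gamma>) \<le> 9 * R * (4 * W + 1)" if "\<gamma> \<in> G" for \<gamma>
    proof -
      note s = card_eis_strip[OF ne[OF that] R2 W]
      show "finite (F \<gamma>)" unfolding F_def by (rule s(1))
      have "card (F \<gamma>) \<le> (4 * (2 * R) + 1) * (4 * W + 1)" unfolding F_def by (rule s(2))
      also have "\<dots> \<le> 9 * R * (4 * W + 1)" using R W by (intro mult_right_mono) auto
      finally show "card (F \<gamma>) \<le> 9 * R * (4 * W + 1)" .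
    qed
    have sub: "P \<subseteq> prod.swap ` Sigma G F"
    proof
      fix p assume "p \<in> P"
      then obtain \<xi> \<gamma> where p: "p = (\<xi>, \<gamma>)" "enorm \<xi> \<le> (2 * R)\<^sup>2" "\<gamma> \<in> G"
        "\<bar>Im (emb \<xi> * emb \<gamma> ^ 3)\<bar> \<le> K"
        by (auto simp: P_def G_def)
      have "W * S ^ 3 \<le> W * cmod (emb \<gamma>) ^ 3"
        using n[OF p(3)] S W by (intro mult_left_mono power_mono) auto
      then have "K \<le> W * cmod (emb \<gamma> ^ 3)" using S by (simp add: W_def norm_power)
      then have "\<xi> \<in> F \<gamma>" using p by (simp add: F_def mult.commute)
      then show "p \<in> prod.swap ` Sigma G F"
        using p by (intro image_eqI[of _ _ "(\<gamma>, \<xi>)"]) auto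
    qed
    have "card P \<le> card (Sigma G F)"
      using surj_card_le[OF card_Sigma_le(1)[OF G(1) F] sub] by blast
    then have "real (card P) \<le> card (Sigma G F)" by simp
    also have "\<dots> \<le> card G * (9 * R * (4 * W + 1))" by (rule card_Sigma_le(2)[OF G(1) F])
    also have "\<dots> \<le> (81 * S\<^sup>2) * (9 * R * (4 * W + 1))"
      using G(2) R W by (intro mult_right_mono) auto
    also have "\<dots> = 729 * (4 * R * K / S + R * S * S)"
      using S by (simp add: W_def field_simps power2_eq_square power3_eq_cube)
    also have "\<dots> \<le> 2187 * (4 * R * K / S + R * S * min R S)"
      using True R S K by (intro mult_mono add_mono) (auto simp: min_def)
    finally show ?thesis .
  next
    case False
    \<comment> \<open>With |r|^3 = |\<xi>| at least R, K is at most W |r|^3 S^2. Dividing by |r|^2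
      S^2, a lower bound for |r\<gamma>|^2, leaves a strip of half-width W relative to |r|.\<close>
    define W where "W = K / (R * S\<^sup>2)"
    have W: "W \<ge> 0" using K R S by (simp add: W_def)
    obtain \<rho> where \<rho>: "\<rho> w ^ 3 = w" for w :: complex using complex_cube_root by metis
    \<comment> \<open>The base carries the rotation index besides \<xi>, which covers the three
      possible strips.\<close>
    define G where "G = {..<3::nat} \<times> {\<xi>. R\<^sup>2 \<le> enorm \<xi> \<and> enorm \<xi> \<le> (2 * R)\<^sup>2}"
    define F where "F = (\<lambda>(i, \<xi>). {\<gamma>. enorm \<gamma> \<le> (2 * S)\<^sup>2
      \<and> \<bar>Im (om ^ i * \<rho> (emb \<xi>) * emb \<gamma>)\<bar> \<le> W * cmod (om ^ i * \<rho> (emb \<xi>))})"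
    have G: "finite G" "card G \<le> 3 * (81 * R\<^sup>2)"
    proof -
      have sub: "{\<xi>. R\<^sup>2 \<le> enorm \<xi> \<and> enorm \<xi> \<le> (2 * R)\<^sup>2} \<subseteq> {z. enorm z \<le> (2 * R)\<^sup>2}" by auto
      then show "finite G" using ball(1)[OF R] finite_subset unfolding G_def by blast
      show "card G \<le> 3 * (81 * R\<^sup>2)"
        using card_mono[OF ball(1)[OF R] sub] ball(2)[OF R]
        by (simp add: G_def card_cartesian_product)
    qed
    have n: "R \<le> cmod (\<rho> (emb \<xi>)) ^ 3" if "(i, \<xi>) \<in> G" for i \<xi>
      using that norm_ge[OF R, of \<xi>] by (simp add: G_def norm_power[symmetric] \<rho>)
    have ne: "om ^ i * \<rho> (emb \<xi>) \<noteq> 0" if "(i, \<xi>) \<in> G" for i \<xi>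
      using n[OF that] R om_cube by auto
    have S2: "0 \<le> 2 * S" using S by simp
    have F: "finite (F p)" "card (F p) \<le> 9 * S * (4 * W + 1)" if p: "p \<in> G" for p
    proof -
      obtain i \<xi> where i: "p = (i, \<xi>)" by (cases p)
      note s = card_eis_strip[OF ne[OF p[unfolded i]] S2 W]
      show "finite (F p)" using s(1) by (simp add: F_def i)
      have "card (F p) \<le> (4 * (2 * S) + 1) * (4 * W + 1)" using s(2) by (simp add: F_def i)
      also have "\<dots> \<le> 9 * S * (4 * W + 1)" using S W by (intro mult_right_mono) auto
      finally show "card (F p) \<le> 9 * S * (4 * W + 1)" .
    qed
    have sub: "P \<subseteq> (\<lambda>((i, \<xi>), \<gamma>). (\<xi>, \<gamma>)) ` Sigma G F"
    proof
      fix p assume "p \<in> P"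
      then obtain \<xi> \<gamma> where p: "p = (\<xi>, \<gamma>)" "R\<^sup>2 \<le> enorm \<xi>" "enorm \<xi> \<le> (2 * R)\<^sup>2"
        "S\<^sup>2 \<le> enorm \<gamma>" "enorm \<gamma> \<le> (2 * S)\<^sup>2" "\<bar>Im (emb \<xi> * emb \<gamma> ^ 3)\<bar> \<le> K"
        by (auto simp: P_def)
      define r where "r = \<rho> (emb \<xi>)"
      obtain i where i: "i < 3"
        "\<bar>Im (om ^ i * (r * emb \<gamma>))\<bar> * (cmod (r * emb \<gamma>))\<^sup>2 \<le> \<bar>Im ((r * emb \<gamma>) ^ 3)\<bar>"
        using Im_cube_rotation by blast
      have iG: "(i, \<xi>) \<in> G" using i p by (simp add: G_def)
      have r: "R \<le> cmod r ^ 3" using n[OF iG] by (simp add: r_def)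
      have r0: "cmod r > 0" using r R by (cases "cmod r = 0") auto
      have "\<bar>Im (om ^ i * (r * emb \<gamma>))\<bar> * ((cmod r)\<^sup>2 * S\<^sup>2)
          \<le> \<bar>Im (om ^ i * (r * emb \<gamma>))\<bar> * (cmod (r * emb \<gamma>))\<^sup>2"
        unfolding norm_mult power_mult_distrib using p(4) cmod_emb[of \<gamma>]
        by (intro mult_left_mono) auto
      also have "\<dots> \<le> \<bar>Im ((r * emb \<gamma>) ^ 3)\<bar>" by (rule i(2))
      also have "\<dots> \<le> K" using p(6) by (simp add: power_mult_distrib r_def \<rho>)
      also have "K = W * R * S\<^sup>2" using R S by (simp add: W_def)
      also have "\<dots> \<le> W * cmod r ^ 3 * S\<^sup>2" using r W by (intro mult_right_mono mult_left_mono) auto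
      also have "\<dots> = W * cmod r * ((cmod r)\<^sup>2 * S\<^sup>2)" by (simp add: power3_eq_cube power2_eq_square)
      finally have "\<bar>Im (om ^ i * (r * emb \<gamma>))\<bar> \<le> W * cmod r"
        by (rule mult_right_le_imp_le) (use r0 S in simp)
      then have "\<gamma> \<in> F (i, \<xi>)"
        using p(5) by (simp add: F_def r_def norm_mult norm_power mult.assoc)
      then show "p \<in> (\<lambda>((i, \<xi>), \<gamma>). (\<xi>, \<gamma>)) ` Sigma G F"
        using p(1) iG by (intro image_eqI[of _ _ "((i, \<xi>), \<gamma>)"]) auto
    qed
    have "card P \<le> card (Sigma G F)"
      using surj_card_le[OF card_Sigma_le(1)[OF G(1) F] sub] by blast
    then have "real (card P) \<le> card (Sigma G F)" by simp
    also have "\<dots> \<le> card G * (9 * S * (4 * W + 1))" by (rule card_Sigma_le(2)[OF G(1) F])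
    also have "\<dots> \<le> (3 * (81 * R\<^sup>2)) * (9 * S * (4 * W + 1))"
      using G(2) S W by (intro mult_right_mono) auto
    also have "\<dots> = 2187 * (4 * R * K / S + R * S * R)"
      using R S by (simp add: W_def field_simps power2_eq_square)
    also have "\<dots> = 2187 * (4 * R * K / S + R * S * min R S)"
      using False by (simp add: min_def)
    finally show ?thesis .
  qed
  with fin show "finite P" "card P \<le> 2187 * (4 * R * K / S + R * S * min R S)" by simp_all
qed

text \<open>All such a have |a| at least 4t/5, while their squares lie in an interval of length 6H.
  Two of the same sign thus differ by at most 6H / (8t/5), hence by at most 4H/t.\<close>

lemma card_large_a:
  fixes I H t :: real
  assumes "t > 0" "t\<^sup>2 \<le> I" "t \<le> 2 * H"
  defines "A \<equiv> {a::int. \<bar>(real_of_int a)\<^sup>2 - I\<bar> \<le> 3 * H \<and> 6 * H \<le> (real_of_int a)\<^sup>2}"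
  shows "finite A" "card A \<le> 20 * H / t"
proof -
  have lower: "4 / 5 * t \<le> \<bar>real_of_int a\<bar>" if "a \<in> A" for a
  proof -
    \<comment> \<open>The deviation 3H is at most a^2/2. Then a^2 is at least 2t^2/3, which exceeds
      (4t/5)^2.\<close>
    have "I \<le> 3 / 2 * (real_of_int a)\<^sup>2" using that by (auto simp: A_def abs_le_iff)
    moreover have "(4 / 5 * t)\<^sup>2 = 16 / 25 * t\<^sup>2" by (simp add: power_mult_distrib power_divide)
    ultimately have "(4 / 5 * t)\<^sup>2 \<le> (real_of_int a)\<^sup>2"
      using assms(2) zero_le_power2[of "real_of_int a"] by linarith
    then have "\<bar>4 / 5 * t\<bar> \<le> \<bar>real_of_int a\<bar>" by (simp only: abs_le_square_iff)
    then show ?thesis using assms(1) by simp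
  qed
  have H: "H > 0" using assms by linarith
  have d: "\<bar>real_of_int x - real_of_int y\<bar> \<le> 4 * H / t"
    if xy: "x \<in> A" "y \<in> A" and same: "\<bar>x + y\<bar> = \<bar>x\<bar> + \<bar>y\<bar>" for x y
  proof -
    have "\<bar>(real_of_int x)\<^sup>2 - (real_of_int y)\<^sup>2\<bar> \<le> 6 * H"
      using xy by (auto simp: A_def abs_le_iff)
    also have "(real_of_int x)\<^sup>2 - (real_of_int y)\<^sup>2
        = (real_of_int x + real_of_int y) * (real_of_int x - real_of_int y)"
      by (simp add: power2_eq_square algebra_simps)
    finally have "\<bar>real_of_int x + real_of_int y\<bar> * \<bar>real_of_int x - real_of_int y\<bar> \<le> 6 * H"
      by (simp add: abs_mult)
    moreover have "8 / 5 * t \<le> \<bar>real_of_int x + real_of_int y\<bar>"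
      using lower[OF xy(1)] lower[OF xy(2)] same by linarith
    then have "8 / 5 * t * \<bar>real_of_int x - real_of_int y\<bar>
        \<le> \<bar>real_of_int x + real_of_int y\<bar> * \<bar>real_of_int x - real_of_int y\<bar>"
      by (rule mult_right_mono) simp
    ultimately have "t * \<bar>real_of_int x - real_of_int y\<bar> \<le> 4 * H" using H by linarith
    then show ?thesis using assms(1) by (simp add: pos_le_divide_eq mult.commute)
  qed
  have d0: "0 \<le> 4 * H / t" using H assms(1) by simp
  have pos: "finite (A \<inter> {0..})" "card (A \<inter> {0..}) \<le> 2 * (4 * H / t) + 1"
    by (rule card_le_diameter[OF d0]; rule d; auto)+
  have neg: "finite (A \<inter> {..0})" "card (A \<inter> {..0}) \<le> 2 * (4 * H / t) + 1"
    by (rule card_le_diameter[OF d0]; rule d; auto)+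
  have A: "A = (A \<inter> {0..}) \<union> (A \<inter> {..0})" by auto
  show "finite A" by (subst A) (use pos neg in blast)
  have "card A \<le> card (A \<inter> {0..}) + card (A \<inter> {..0})" by (subst A) (rule card_Un_le)
  then have "real (card A) \<le> real (card (A \<inter> {0..})) + real (card (A \<inter> {..0}))"
    by (simp flip: of_nat_add)
  also have "\<dots> \<le> (2 * (4 * H / t) + 1) + (2 * (4 * H / t) + 1)"
    using pos(2) neg(2) by (rule add_mono)
  also have "\<dots> = 2 * (2 * (4 * H / t) + 1)" by simp
  \<comment> \<open>The two signs contribute 16H/t + 2, and 2 is at most 4H/t because t \<le>
    2H.\<close>
  also have "\<dots> \<le> 20 * H / t"
  proof -
    have "1 \<le> 2 * H / t" using assms by simp
    then show ?thesis by simp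
  qed
  finally show "card A \<le> 20 * H / t" .
qed

section \<open>Counting parameters in dyadic boxes\<close>

definition box :: "real \<Rightarrow> real \<Rightarrow> real \<Rightarrow> (int \<times> eis \<times> eis) set" where
  "box H R S = {(a, \<xi>, \<gamma>) \<in> param H.
     R\<^sup>2 \<le> real_of_int (enorm \<xi>) \<and> real_of_int (enorm \<xi>) \<le> (2 * R)\<^sup>2
     \<and> S\<^sup>2 \<le> real_of_int (enorm \<gamma>) \<and> real_of_int (enorm \<gamma>) \<le> (2 * S)\<^sup>2}"

text \<open>A single member of the box shows R^2 S^2 \<le> I \<le> a^2 + 3H \<le> 9H. It then
  suffices to multiply the trivial counts for a, \<xi> and \<gamma>, which are at most 6 sqrt H, 81
  R^2 and 81 S^2.\<close>

lemma card_box_small: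
  fixes H R S :: real
  assumes H: "H \<ge> 1" and R: "R \<ge> 1" and S: "S \<ge> 1"
  defines "A \<equiv> {(a, \<xi>, \<gamma>) \<in> box H R S. (real_of_int a)\<^sup>2 < 6 * H}"
  shows "finite A" "card A \<le> 10 ^ 6 * (H * sqrt H)"
proof -
  define X where "X = {a::int. \<bar>real_of_int a - 0\<bar> \<le> 5 / 2 * sqrt H}"
  define Y where "Y = (\<lambda>T::real. {z. enorm z \<le> (2 * T)\<^sup>2})"
  have sH: "sqrt H \<ge> 1" using H by simp
  have "0 \<le> 5 / 2 * sqrt H" using H by simp
  note X = card_abs_interval[OF this, of 0, folded X_def]
  have cardX: "card X \<le> 6 * sqrt H" using X(2) sH by linarith
  have Y: "finite (Y T)" "card (Y T) \<le> 81 * T\<^sup>2" if "T \<ge> 1" for T :: real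
    unfolding Y_def by (rule card_eis_ball_double[OF that])+
  have sub: "A \<subseteq> X \<times> Y R \<times> Y S"
  proof
    fix p assume "p \<in> A"
    then obtain a \<xi> \<gamma> where p: "p = (a, \<xi>, \<gamma>)" "(a, \<xi>, \<gamma>) \<in> box H R S" "(real_of_int a)\<^sup>2 < 6 * H"
      by (auto simp: A_def)
    have "(real_of_int a)\<^sup>2 \<le> (5 / 2 * sqrt H)\<^sup>2"
      using p(3) H by (simp add: power_mult_distrib power_divide)
    then have "\<bar>real_of_int a\<bar> \<le> \<bar>5 / 2 * sqrt H\<bar>" by (simp only: abs_le_square_iff)
    then have "a \<in> X" using H by (simp add: X_def)
    then show "p \<in> X \<times> Y R \<times> Y S" using p by (simp add: box_def Y_def)
  qed
  have fin: "finite (X \<times> Y R \<times> Y S)" using X Y R S by auto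
  show "finite A" by (rule finite_subset[OF sub fin])
  show "card A \<le> 10 ^ 6 * (H * sqrt H)"
  proof (cases "A = {}")
    case False
    then obtain a \<xi> \<gamma> where p: "(a, \<xi>, \<gamma>) \<in> box H R S" "(real_of_int a)\<^sup>2 < 6 * H"
      by (auto simp: A_def)
    have "R\<^sup>2 * S\<^sup>2 \<le> real_of_int (enorm \<xi>) * real_of_int (enorm \<gamma>)"
      using p(1) by (intro mult_mono) (auto simp: box_def)
    also have "\<dots> \<le> 9 * H"
      using param_size(2)[of a \<xi> \<gamma> H] p by (simp add: box_def abs_le_iff)
    finally have RS: "R\<^sup>2 * S\<^sup>2 \<le> 9 * H" .
    have "card A \<le> card (X \<times> Y R \<times> Y S)" by (rule card_mono[OF fin sub])
    then have "real (card A) \<le> real (card X) * (real (card (Y R)) * real (card (Y S)))"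
      by (simp add: card_cartesian_product flip: of_nat_mult)
    also have "\<dots> \<le> (6 * sqrt H) * ((81 * R\<^sup>2) * (81 * S\<^sup>2))"
      using cardX Y[OF R] Y[OF S] sH by (intro mult_mono) auto
    also have "\<dots> = (39366 * sqrt H) * (R\<^sup>2 * S\<^sup>2)" by simp
    also have "\<dots> \<le> (39366 * sqrt H) * (9 * H)" using RS sH by (intro mult_left_mono) auto
    also have "\<dots> \<le> 10 ^ 6 * (H * sqrt H)" using H sH by simp
    finally show ?thesis .
  qed (use H in simp)
qed

text \<open>The product of the number of pairs (\<xi>, \<gamma>) from the strip count with the
  number of a from \<open>card_large_a\<close>.\<close>

lemma card_box_large:
  fixes H R S :: real
  assumes H: "H \<ge> 1" and R: "R \<ge> 1" and S: "S \<ge> 1"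
  defines "A \<equiv> {(a, \<xi>, \<gamma>) \<in> box H R S. 6 * H \<le> (real_of_int a)\<^sup>2}"
  shows "finite A" "card A \<le> 10 ^ 8 * (H * sqrt H)"
proof -
  have sH: "sqrt H \<ge> 1" using H by simp
  have "finite A \<and> card A \<le> 10 ^ 8 * (H * sqrt H)"
  proof (cases "A = {}")
    case False
    define t where "t = R * S"
    have t: "t > 0" using R S by (simp add: t_def)
    have I: "t\<^sup>2 \<le> real_of_int (enorm \<xi>) * real_of_int (enorm \<gamma>)"
      "real_of_int (enorm \<xi>) * real_of_int (enorm \<gamma>) \<le> 16 * t\<^sup>2"
      if "R\<^sup>2 \<le> enorm \<xi>" "enorm \<xi> \<le> (2 * R)\<^sup>2" "S\<^sup>2 \<le> enorm \<gamma>" "enorm \<gamma> \<le> (2 * S)\<^sup>2" for \<xi> \<gamma>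
      using mult_mono[OF that(1,3)] mult_mono[OF that(2,4)]
      by (simp_all add: t_def power_mult_distrib)
    \<comment> \<open>One member of the box pins down t = RS: I is at least a^2/2, hence at least
      3H, and at most H^2 + 3H, while t^2 \<le> I \<le> 16t^2.\<close>
    obtain a \<xi> \<gamma> where p: "(a, \<xi>, \<gamma>) \<in> box H R S" "6 * H \<le> (real_of_int a)\<^sup>2"
      using False by (auto simp: A_def)
    have "(real_of_int a)\<^sup>2 \<le> H\<^sup>2"
      using param_size(1)[of a \<xi> \<gamma> H] p(1) square_le_if_abs_le by (simp add: box_def)
    moreover have "H \<le> H\<^sup>2" using H by (simp add: power2_eq_square)
    ultimately have t2: "3 * H \<le> 16 * t\<^sup>2" "t\<^sup>2 \<le> 4 * H\<^sup>2"
      using param_size(2)[of a \<xi> \<gamma> H] p I[of \<xi> \<gamma>] by (simp_all add: box_def abs_le_iff)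
    have tH: "t \<le> 2 * H"
    proof (rule power2_le_imp_le)
      show "t\<^sup>2 \<le> (2 * H)\<^sup>2" using t2(2) by (simp add: power_mult_distrib)
    qed (use H in simp)
    \<comment> \<open>From |a| \<le> 6t, \<open>param_angle\<close> bounds the imaginary part by
      84tH/R^2, and K is 120tH/R^2.\<close>
    define K where "K = 120 * S * H / R"
    have K: "K \<ge> 0" using H R S by (simp add: K_def)
    define P where "P = {(\<xi>, \<gamma>). R\<^sup>2 \<le> enorm \<xi> \<and> enorm \<xi> \<le> (2 * R)\<^sup>2 \<and> S\<^sup>2 \<le> enorm \<gamma> \<and> enorm \<gamma> \<le> (2 * S)\<^sup>2
      \<and> \<bar>Im (emb \<xi> * emb \<gamma> ^ 3)\<bar> \<le> K}"
    have P: "finite P" "card P \<le> 2187 * (4 * R * K / S + R * S * min R S)"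
      unfolding P_def by (rule card_pairs_small_imaginary_part[OF R S K])+
    define F where "F = (\<lambda>(\<xi>, \<gamma>). {a::int. \<bar>(real_of_int a)\<^sup>2 - real_of_int (enorm \<xi>) * real_of_int (enorm \<gamma>)\<bar> \<le> 3 * H
      \<and> 6 * H \<le> (real_of_int a)\<^sup>2})"
    have F: "finite (F p)" "card (F p) \<le> 20 * H / t" if "p \<in> P" for p
    proof -
      obtain \<xi> \<gamma> where p: "p = (\<xi>, \<gamma>)" by (cases p)
      then have "t\<^sup>2 \<le> real_of_int (enorm \<xi>) * real_of_int (enorm \<gamma>)"
        using I(1) that by (simp add: P_def)
      from card_large_a[OF t this tH] show "finite (F p)" "card (F p) \<le> 20 * H / t"
        by (simp_all add: F_def p)
    qed
    have sub: "A \<subseteq> (\<lambda>((\<xi>, \<gamma>), a). (a, \<xi>, \<gamma>)) ` Sigma P F"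
    proof
      fix p assume "p \<in> A"
      then obtain a \<xi> \<gamma> where p: "p = (a, \<xi>, \<gamma>)" "(a, \<xi>, \<gamma>) \<in> box H R S" "6 * H \<le> (real_of_int a)\<^sup>2"
        by (auto simp: A_def)
      then have par: "(a, \<xi>, \<gamma>) \<in> param H" and n: "R\<^sup>2 \<le> enorm \<xi>" "enorm \<xi> \<le> (2 * R)\<^sup>2"
        "S\<^sup>2 \<le> enorm \<gamma>" "enorm \<gamma> \<le> (2 * S)\<^sup>2"
        by (auto simp: box_def)
      note sz = param_size(2)[OF par]
      have "(real_of_int a)\<^sup>2 \<le> 32 * t\<^sup>2" using sz p(3) I(2)[OF n] by (simp add: abs_le_iff)
      moreover have "(6 * t)\<^sup>2 = 36 * t\<^sup>2" by (simp add: power_mult_distrib)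
      ultimately have "(real_of_int a)\<^sup>2 \<le> (6 * t)\<^sup>2"
        using zero_le_power2[of t] by linarith
      then have "\<bar>real_of_int a\<bar> \<le> \<bar>6 * t\<bar>" by (simp only: abs_le_square_iff)
      then have at: "\<bar>real_of_int a\<bar> \<le> 6 * t" using t by simp
      have "\<bar>Im (emb \<xi> * emb \<gamma> ^ 3)\<bar> * R\<^sup>2 \<le> \<bar>Im (emb \<xi> * emb \<gamma> ^ 3)\<bar> * real_of_int (enorm \<xi>)"
        using n(1) by (intro mult_left_mono) auto
      also have "\<dots> \<le> 14 * (\<bar>real_of_int a\<bar> * H)" by (rule param_angle[OF par H p(3)])
      also have "\<dots> \<le> 14 * (6 * t * H)" using at H by (intro mult_left_mono mult_right_mono) auto
      also have "\<dots> \<le> 120 * (t * H)" using t H by simp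
      also have "\<dots> = K * R\<^sup>2" using R by (simp add: K_def t_def power2_eq_square)
      finally have "\<bar>Im (emb \<xi> * emb \<gamma> ^ 3)\<bar> \<le> K" by (rule mult_right_le_imp_le) (use R in simp)
      then have "(\<xi>, \<gamma>) \<in> P" using n by (simp add: P_def)
      moreover have "a \<in> F (\<xi>, \<gamma>)" using sz p(3) by (simp add: F_def)
      ultimately show "p \<in> (\<lambda>((\<xi>, \<gamma>), a). (a, \<xi>, \<gamma>)) ` Sigma P F"
        using p(1) by (intro image_eqI[of _ _ "((\<xi>, \<gamma>), a)"]) auto
    qed
    have fin: "finite (Sigma P F)" by (rule card_Sigma_le(1)[OF P(1) F])
    define m where "m = min R S"
    have m: "m \<ge> 0" using R S by (simp add: m_def)
    \<comment> \<open>The smaller of R and S is at most sqrt t, hence of order sqrt H by t \<le> 2H;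
      this controls the second term of the strip count.\<close>
    have "m * m \<le> t" unfolding m_def t_def using R S by (intro mult_mono) auto
    then have "m\<^sup>2 \<le> (2 * sqrt H)\<^sup>2"
      using tH H by (simp add: power2_eq_square)
    then have mH: "m \<le> 2 * sqrt H" by (rule power2_le_imp_le) (use sH in simp)
    have "(sqrt H)\<^sup>2 \<le> (4 * t)\<^sup>2" using t2(1) H by (simp add: power_mult_distrib)
    then have st: "sqrt H \<le> 4 * t" by (rule power2_le_imp_le) (use t in simp)
    have "card A \<le> card (Sigma P F)" using surj_card_le[OF fin sub] .
    then have "real (card A) \<le> card (Sigma P F)" by simp
    also have "\<dots> \<le> card P * (20 * H / t)" by (rule card_Sigma_le(2)[OF P(1) F])
    also have "\<dots> \<le> 2187 * (4 * R * K / S + R * S * min R S) * (20 * H / t)"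
      using P(2) H t by (intro mult_right_mono) auto
    also have "\<dots> = 2187 * (480 * H + t * m) * (20 * H / t)"
      using R S by (simp add: K_def t_def m_def)
    also have "\<dots> = 20995200 * (H * (H / t)) + 43740 * (H * m)"
      using t by (simp add: field_simps)
    also have "\<dots> \<le> 20995200 * (H * (4 * sqrt H)) + 43740 * (H * (2 * sqrt H))"
    proof -
      \<comment> \<open>The first term, of order H^2/t, needs the opposite bound: t is at least of
        order sqrt H.\<close>
      have "H = sqrt H * sqrt H" using H by simp
      also have "\<dots> \<le> 4 * t * sqrt H" using st sH by (intro mult_right_mono) auto
      finally have "H / t \<le> 4 * sqrt H" using t by (simp add: pos_divide_le_eq mult_ac)
      then show ?thesis using mH H by (intro add_mono mult_left_mono) auto
    qed
    also have "\<dots> \<le> 10 ^ 8 * (H * sqrt H)" using H sH by simp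
    finally have "card A \<le> 10 ^ 8 * (H * sqrt H)" .
    moreover have "finite A" by (rule finite_surj[OF fin sub])
    ultimately show ?thesis by blast
  qed (use H in simp)
  then show "finite A" "card A \<le> 10 ^ 8 * (H * sqrt H)" by auto
qed

lemma card_box:
  fixes H R S :: real
  assumes H: "H \<ge> 1" and R: "R \<ge> 1" and S: "S \<ge> 1"
  shows "finite (box H R S)" "card (box H R S) \<le> 2 * 10 ^ 8 * (H * sqrt H)"
proof -
  note s = card_box_small[OF H R S] and l = card_box_large[OF H R S]
  have eq: "box H R S = {(a, \<xi>, \<gamma>) \<in> box H R S. (real_of_int a)\<^sup>2 < 6 * H}
      \<union> {(a, \<xi>, \<gamma>) \<in> box H R S. 6 * H \<le> (real_of_int a)\<^sup>2}" (is "_ = ?A \<union> ?B")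
    by auto
  show "finite (box H R S)" by (subst eq) (use s(1) l(1) in blast)
  have "card (box H R S) \<le> card ?A + card ?B" by (subst eq) (rule card_Un_le)
  then have "real (card (box H R S)) \<le> real (card ?A) + card ?B" by linarith
  also have "\<dots> \<le> 10 ^ 6 * (H * sqrt H) + 10 ^ 8 * (H * sqrt H)" using s(2) l(2) by (rule add_mono)
  also have "\<dots> \<le> 2 * 10 ^ 8 * (H * sqrt H)" using H by simp
  finally show "card (box H R S) \<le> 2 * 10 ^ 8 * (H * sqrt H)" .
qed

lemma dyadic_range:
  fixes n :: int and x :: real
  assumes "n \<ge> 1" "real_of_int n \<le> x\<^sup>2" "x \<ge> 1"
  obtains i where "i \<le> nat \<lfloor>log 2 x\<rfloor>" "(2 ^ i)\<^sup>2 \<le> real_of_int n" "real_of_int n \<le> (2 * 2 ^ i)\<^sup>2"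
proof -
  define y where "y = sqrt (real_of_int n)"
  have y: "1 \<le> y" "y \<le> x" "y\<^sup>2 = real_of_int n"
    using assms by (auto simp: y_def real_le_lsqrt)
  define i where "i = nat \<lfloor>log 2 y\<rfloor>"
  have l0: "0 \<le> log 2 y" using y(1) by simp
  have fl: "real i \<le> log 2 y" "log 2 y \<le> real i + 1" using l0 unfolding i_def by linarith+
  have "2 ^ i \<le> y" using fl(1) y(1) by (simp add: le_log_iff powr_realpow)
  then have "(2 ^ i)\<^sup>2 \<le> y\<^sup>2" by (intro power_mono) auto
  moreover have "y \<le> 2 * 2 ^ i"
    using fl(2) y(1) by (simp add: log_le_iff powr_add powr_realpow)
  then have "y\<^sup>2 \<le> (2 * 2 ^ i)\<^sup>2" using y(1) by (intro power_mono) auto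
  moreover have "log 2 y \<le> log 2 x" using y by simp
  then have "i \<le> nat \<lfloor>log 2 x\<rfloor>" unfolding i_def by (intro nat_mono floor_mono)
  ultimately show ?thesis using that y(3) by auto
qed

lemma card_param:
  assumes H: "H \<ge> 1"
  shows "finite (param H)" "card (param H) \<le> (log 2 (2 * H) + 1)\<^sup>2 * (2 * 10 ^ 8 * (H * sqrt H))"
proof -
  define L where "L = nat \<lfloor>log 2 (2 * H)\<rfloor>"
  define B where "B = (\<lambda>(i, j). box H (2 ^ i) (2 ^ j))"
  have sub: "param H \<subseteq> snd ` Sigma ({..L} \<times> {..L}) B"
  proof
    fix p assume p: "p \<in> param H"
    then obtain a \<xi> \<gamma> where eq: "p = (a, \<xi>, \<gamma>)" by (cases p)
    have pos: "enorm \<xi> * enorm \<gamma> > 0" using p by (auto simp: eq param_def)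
    then have n: "enorm \<xi> \<ge> 1" "enorm \<gamma> \<ge> 1"
      using enorm_nonneg[of \<xi>] enorm_nonneg[of \<gamma>] by (auto simp: zero_less_mult_iff)
    have "(real_of_int a)\<^sup>2 \<le> H\<^sup>2"
      using param_size(1)[OF p[unfolded eq]] square_le_if_abs_le by blast
    moreover have "H \<le> H\<^sup>2" using H by (simp add: power2_eq_square)
    ultimately have I: "real_of_int (enorm \<xi>) * real_of_int (enorm \<gamma>) \<le> (2 * H)\<^sup>2"
      using param_size(2)[OF p[unfolded eq]] by (simp add: abs_le_iff power_mult_distrib)
    \<comment> \<open>Both norms are at least 1 and their product is at most H^2 + 3H, so each is at
      most (2H)^2 and \<open>L\<close> + 1 dyadic ranges suffice for each.\<close>
    have "real_of_int (enorm \<xi>) * 1 \<le> real_of_int (enorm \<xi>) * real_of_int (enorm \<gamma>)"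
      "1 * real_of_int (enorm \<gamma>) \<le> real_of_int (enorm \<xi>) * real_of_int (enorm \<gamma>)"
      using n by (intro mult_left_mono mult_right_mono; simp)+
    then have le: "real_of_int (enorm \<xi>) \<le> (2 * H)\<^sup>2" "real_of_int (enorm \<gamma>) \<le> (2 * H)\<^sup>2"
      using I by simp_all
    have H2: "1 \<le> 2 * H" using H by simp
    obtain i where i: "i \<le> L" "(2 ^ i)\<^sup>2 \<le> real_of_int (enorm \<xi>)" "real_of_int (enorm \<xi>) \<le> (2 * 2 ^ i)\<^sup>2"
      using dyadic_range[OF n(1) le(1) H2] unfolding L_def by blast
    obtain j where j: "j \<le> L" "(2 ^ j)\<^sup>2 \<le> real_of_int (enorm \<gamma>)" "real_of_int (enorm \<gamma>) \<le> (2 * 2 ^ j)\<^sup>2"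
      using dyadic_range[OF n(2) le(2) H2] unfolding L_def by blast
    have "p \<in> B (i, j)" using p i j by (simp add: B_def box_def eq)
    then show "p \<in> snd ` Sigma ({..L} \<times> {..L}) B"
      using i(1) j(1) by (intro image_eqI[of _ _ "((i, j), p)"]) auto
  qed
  have B: "finite (B p)" "card (B p) \<le> 2 * 10 ^ 8 * (H * sqrt H)" for p
  proof -
    obtain i j where p: "p = (i, j)" by (cases p)
    have "1 \<le> (2::real) ^ i" "1 \<le> (2::real) ^ j" by simp_all
    from card_box[OF H this] show "finite (B p)" "card (B p) \<le> 2 * 10 ^ 8 * (H * sqrt H)"
      by (simp_all add: B_def p)
  qed
  have finL: "finite ({..L} \<times> {..L})" by simp
  note fin = card_Sigma_le(1)[OF finL B]
  show "finite (param H)" by (rule finite_surj[OF fin sub])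
  have "card (param H) \<le> card (Sigma ({..L} \<times> {..L}) B)" by (rule surj_card_le[OF fin sub])
  then have "real (card (param H)) \<le> card (Sigma ({..L} \<times> {..L}) B)" by simp
  also have "\<dots> \<le> card ({..L} \<times> {..L}) * (2 * 10 ^ 8 * (H * sqrt H))"
    by (rule card_Sigma_le(2)[OF finL B])
  also have "real (card ({..L} \<times> {..L})) = (real L + 1)\<^sup>2"
    by (simp add: card_cartesian_product power2_eq_square algebra_simps)
  also have "(real L + 1)\<^sup>2 * (2 * 10 ^ 8 * (H * sqrt H))
      \<le> (log 2 (2 * H) + 1)\<^sup>2 * (2 * 10 ^ 8 * (H * sqrt H))"
  proof -
    have "0 \<le> log 2 (2 * H)" using H by simp
    then have "real L \<le> log 2 (2 * H)" unfolding L_def by linarith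
    then show ?thesis using H by (intro mult_right_mono power_mono) auto
  qed
  finally show "card (param H) \<le> (log 2 (2 * H) + 1)\<^sup>2 * (2 * 10 ^ 8 * (H * sqrt H))" .
qed

section \<open>From cubics with square discriminant to parameters\<close>

lemma square_disc_param:
  fixes a b c Y :: int
  assumes size: "\<bar>real_of_int a\<bar> \<le> H" "\<bar>real_of_int b\<bar> \<le> H" "\<bar>real_of_int c\<bar> \<le> H"
    and disc: "Y\<^sup>2 = cubic_disc a b c" and I: "a\<^sup>2 - 3 * b \<noteq> 0"
  shows "\<exists>\<xi> \<gamma>. (a, \<xi>, \<gamma>) \<in> param H \<and> a\<^sup>2 - 3 * b = enorm \<xi> * enorm \<gamma>
    \<and> 2 * a ^ 3 - 9 * a * b + 27 * c
      = 2 * cx (of_int (enorm \<xi>) * \<xi> * \<gamma> ^ 3) - cy (of_int (enorm \<xi>) * \<xi> * \<gamma> ^ 3)"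
proof -
  define I where "I = a\<^sup>2 - 3 * b"
  define J where "J = 2 * a ^ 3 - 9 * a * b + 27 * c"
  \<comment> \<open>With I nonzero, this identity also yields I > 0.\<close>
  have IJ: "4 * I ^ 3 = J\<^sup>2 + 27 * Y\<^sup>2"
    unfolding disc I_def J_def cubic_disc_def
    by (simp add: power2_eq_square power3_eq_cube algebra_simps)
  have "I ^ 3 \<ge> 0" using IJ zero_le_power2[of J] zero_le_power2[of Y] by linarith
  then have I0: "I > 0" using I by (simp add: I_def[symmetric] zero_le_power_eq less_le)
  \<comment> \<open>J and Y have the same parity, so (J + 3Y)/2 is an integer.\<close>
  have "even (J\<^sup>2 + 27 * Y\<^sup>2)" unfolding IJ[symmetric] by simp
  then have "even (J + 3 * Y)" by simp
  then obtain k where k: "J + 3 * Y = 2 * k" by (elim evenE)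
  \<comment> \<open>This is (J + 3Y sqrt(-3))/2 in the basis 1, \<omega>, because sqrt(-3) =
    2\<omega> + 1.\<close>
  define \<alpha> where "\<alpha> = Eis k (3 * Y)"
  have J: "J = 2 * k - 3 * Y" using k by simp
  have "4 * enorm \<alpha> = 4 * I ^ 3"
    unfolding IJ J by (simp add: \<alpha>_def enorm_def power2_eq_square algebra_simps)
  then have "enorm \<alpha> = I ^ 3" by simp
  then obtain \<xi> \<gamma> where \<xi>: "\<alpha> = of_int (enorm \<xi>) * \<xi> * \<gamma> ^ 3" "enorm \<xi> * enorm \<gamma> = I"
    using norm_cube_decomposition[OF I0] by blast
  have J': "2 * cx \<alpha> - cy \<alpha> = J" and disc': "(cy \<alpha>)\<^sup>2 = 9 * cubic_disc a b c"
    using J disc by (simp_all add: \<alpha>_def power_mult_distrib)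
  have "(a, \<xi>, \<gamma>) \<in> param H"
    unfolding param_def mem_Collect_eq split \<xi>(1)[symmetric]
    by (intro exI[of _ b] exI[of _ c] conjI)
      (simp_all only: size \<xi>(2) I0 J' disc' I_def[symmetric] J_def[symmetric])
  then show ?thesis
    unfolding I_def[symmetric] J_def[symmetric] using \<xi> J' by (intro exI[of _ \<xi>] exI[of _ \<gamma>]) simp
qed

text \<open>If I = 0, then J^2 + 27Y^2 = 4I^3 forces J = 0. Solving I = J = 0 for b and c gives the
  polynomial (X + a/3)^3, which is reducible.\<close>

lemma irreducible_imp_invariant_nonzero:
  fixes a b c :: int
  assumes irr: "irreducible [:of_int c, of_int b, of_int a, 1 :: rat:]"
    and disc: "Y\<^sup>2 = cubic_disc a b c"
  shows "a\<^sup>2 - 3 * b \<noteq> 0"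
proof
  assume 0: "a\<^sup>2 - 3 * b = 0"
  have "4 * (a\<^sup>2 - 3 * b) ^ 3 = (2 * a ^ 3 - 9 * a * b + 27 * c)\<^sup>2 + 27 * Y\<^sup>2"
    unfolding disc cubic_disc_def by (simp add: power2_eq_square power3_eq_cube algebra_simps)
  then have "(2 * a ^ 3 - 9 * a * b + 27 * c)\<^sup>2 + 27 * Y\<^sup>2 = 0" using 0 by simp
  then have "(2 * a ^ 3 - 9 * a * b + 27 * c)\<^sup>2 = 0"
    using zero_le_power2[of "2 * a ^ 3 - 9 * a * b + 27 * c"] zero_le_power2[of Y] by linarith
  then have J: "2 * a ^ 3 - 9 * a * b + 27 * c = 0" by simp
  have b: "3 * b = a\<^sup>2" using 0 by simp
  have "9 * a * b = 3 * a * (3 * b)" by simp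
  also have "\<dots> = 3 * a ^ 3" unfolding b by (simp add: power2_eq_square power3_eq_cube)
  finally have c: "27 * c = a ^ 3" using J by simp
  let ?a = "of_int a :: rat"
  have "of_int (3 * b) = (of_int (a\<^sup>2) :: rat)" "of_int (27 * c) = (of_int (a ^ 3) :: rat)"
    using b c by simp_all
  then have bc: "of_int b = ?a\<^sup>2 / 3" "of_int c = ?a ^ 3 / 27" by simp_all
  have "[:of_int c, of_int b, ?a, 1:] = [:?a / 3, 1:] * [:?a\<^sup>2 / 9, 2 * ?a / 3, 1:]"
    unfolding bc by (simp add: power2_eq_square power3_eq_cube)
  then have "is_unit [:?a / 3, 1:] \<or> is_unit [:?a\<^sup>2 / 9, 2 * ?a / 3, 1:]"
    using irr irreducibleD by blast
  then show False by (auto simp: is_unit_iff_degree)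
qed

lemma count_non_S3_le:
  assumes H: "H \<ge> 1"
  shows "real (count_non_S3 H) \<le> (log 2 (2 * H) + 1)\<^sup>2 * (2 * 10 ^ 8 * (H * sqrt H))"
proof -
  \<comment> \<open>I determines b and then the trace J determines c. On triples coming from cubics
    both divisions are exact, so every counted cubic is an image of a parameter.\<close>
  define recover :: "int \<times> eis \<times> eis \<Rightarrow> int \<times> int \<times> int" where
    "recover = (\<lambda>(a, \<xi>, \<gamma>). let b = (a\<^sup>2 - enorm \<xi> * enorm \<gamma>) div 3;
       \<alpha> = of_int (enorm \<xi>) * \<xi> * \<gamma> ^ 3
     in (a, b, (2 * cx \<alpha> - cy \<alpha> - 2 * a ^ 3 + 9 * a * b) div 27))"
  let ?N = "{(a::int, b::int, c::int).
      \<bar>real_of_int a\<bar> \<le> H \<and> \<bar>real_of_int b\<bar> \<le> H \<and> \<bar>real_of_int c\<bar> \<le> H \<and>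
      irreducible [:of_int c, of_int b, of_int a, 1 :: rat:] \<and>
      \<not> (galois_group [:of_int c, of_int b, of_int a, 1 :: rat:] \<cong> sym_group 3)}"
  have "?N \<subseteq> recover ` param H"
  proof
    fix p assume "p \<in> ?N"
    then obtain a b c where p: "p = (a, b, c)"
      and size: "\<bar>real_of_int a\<bar> \<le> H" "\<bar>real_of_int b\<bar> \<le> H" "\<bar>real_of_int c\<bar> \<le> H"
      and irr: "irreducible [:of_int c, of_int b, of_int a, 1 :: rat:]"
      and gal: "\<not> (galois_group [:of_int c, of_int b, of_int a, 1 :: rat:] \<cong> sym_group 3)"
      by auto
    obtain Y where Y: "Y\<^sup>2 = cubic_disc a b c" using non_S3_imp_square_disc[OF irr gal] by blast
    obtain \<xi> \<gamma> where \<xi>: "(a, \<xi>, \<gamma>) \<in> param H" "a\<^sup>2 - 3 * b = enorm \<xi> * enorm \<gamma>"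
      "2 * a ^ 3 - 9 * a * b + 27 * c
      = 2 * cx (of_int (enorm \<xi>) * \<xi> * \<gamma> ^ 3) - cy (of_int (enorm \<xi>) * \<xi> * \<gamma> ^ 3)"
      using square_disc_param[OF size Y irreducible_imp_invariant_nonzero[OF irr Y]] by blast
    have "p = recover (a, \<xi>, \<gamma>)"
      unfolding recover_def p Let_def split \<xi>(2)[symmetric] \<xi>(3)[symmetric] by simp
    then show "p \<in> recover ` param H" using \<xi>(1) by blast
  qed
  then have "count_non_S3 H \<le> card (param H)"
    unfolding count_non_S3_def using card_param(1)[OF H] by (intro surj_card_le)
  then show ?thesis using card_param(2)[OF H] by linarith
qed

theorem theorem1p2:
  fixes \<epsilon> :: real
  assumes "\<epsilon> > 0"
  shows "(\<lambda>H. real (count_non_S3 H)) \<in> O[at_top](\<lambda>H. H powr (3/2 + \<epsilon>))"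
proof -
  have "eventually (\<lambda>H. norm (real (count_non_S3 H))
      \<le> norm ((log 2 (2 * H) + 1)\<^sup>2 * (2 * 10 ^ 8 * (H * sqrt H)))) at_top"
    using eventually_ge_at_top[of 1]
  proof eventually_elim
    case (elim H)
    then show ?case using count_non_S3_le[of H] by simp
  qed
  then have "(\<lambda>H. real (count_non_S3 H))
      \<in> O[at_top](\<lambda>H. (log 2 (2 * H) + 1)\<^sup>2 * (2 * 10 ^ 8 * (H * sqrt H)))"
    by (rule landau_o.big_mono)
  \<comment> \<open>The squared logarithm from the number of boxes is absorbed by
    H^\<epsilon>.\<close>
  also have "(\<lambda>H. (log 2 (2 * H) + 1)\<^sup>2 * (2 * 10 ^ 8 * (H * sqrt H)))
      \<in> O[at_top](\<lambda>H. H powr (3/2 + \<epsilon>))"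
    using assms by real_asymp
  finally show ?thesis .
qed

end
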